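(* There exists a non-computable oracle $X$ which is low for speed.
   Context: Oracles are languages $X\subseteq\{0,1\}^*$; via the identification of the $(n+1)$-th string in length-lexicographic order with $n$, they are also viewed as subsets of $\mathbb{N}$ and as infinite binary sequences in $\{0,1\}^\omega$. Oracle computations are measured in the usual complexity-theoretic model: the machine has a query tape, and once a string $x$ is written on it, the answer to "is $x\in X$?" is obtained in time $O(1)$. An oracle $X$ is \emph{low for speed} if for every computable (decidable) language $L$: whenever some oracle Turing machine $M$ with oracle $X$ decides $L$ within time bound $f$ (i.e. $time(M^X,x)\le f(x)$ for all inputs $x$), there exist a Turing machine $M'$ without oracle and a polynomial $p$ such that $M'$ decides $L$ within time bound $p\circ f$. *)

theory Defs
  imports Main "HOL-Computational_Algebra.Polynomial"
begin

text \<open>Oracle Turing machines over the binary input alphabet.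
  A machine has one work tape (initially holding the input) and one query tape,
  both one-way infinite, over the tape alphabet {blank, 0, 1}.  When the machine
  enters its query state, the oracle is asked about the binary word written on the
  query tape (from the leftmost cell up to the first blank) and in a single step the
  machine moves to the yes- or no-answer state.  Machines without oracle are those
  machines which can never enter the query state.\<close>

datatype symbol = Bk | S0 | S1

datatype move = MoveL | MoveR | Stay

text \<open>A tape: reversed list of cells left of the head, and the list of cells
  from the head position to the right (missing cells are blank).\<close>
type_synonym tape = "symbol list \<times> symbol list"

fun tape_read :: "tape \<Rightarrow> symbol" where
  "tape_read (l, []) = Bk"
| "tape_read (l, a # r) = a"

fun tape_write :: "symbol \<Rightarrow> tape \<Rightarrow> tape" where
  "tape_write a (l, []) = (l, [a])"
| "tape_write a (l, b # r) = (l, a # r)"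

fun tape_move :: "move \<Rightarrow> tape \<Rightarrow> tape" where
  "tape_move Stay t = t"
| "tape_move MoveL ([], r) = ([], r)"
| "tape_move MoveL (a # l, r) = (l, a # r)"
| "tape_move MoveR (l, []) = (Bk # l, [])"
| "tape_move MoveR (l, a # r) = (a # l, r)"

fun sym_of_bit :: "bool \<Rightarrow> symbol" where
  "sym_of_bit False = S0"
| "sym_of_bit True = S1"

fun bit_of_sym :: "symbol \<Rightarrow> bool" where
  "bit_of_sym S1 = True"
| "bit_of_sym _ = False"

definition tape_word :: "tape \<Rightarrow> bool list" where
  "tape_word t = map bit_of_sym (takeWhile (\<lambda>a. a \<noteq> Bk) (rev (fst t) @ snd t))"

record otm =
  nstates :: nat
  delta :: "nat \<Rightarrow> symbol \<Rightarrow> symbol \<Rightarrow> nat \<times> symbol \<times> move \<times> symbol \<times> move"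
  start :: nat
  acc :: nat
  rej :: nat
  qry :: nat
  qyes :: nat
  qno :: nat

definition wf_otm :: "otm \<Rightarrow> bool" where
  "wf_otm M \<longleftrightarrow>
     start M < nstates M \<and> acc M < nstates M \<and> rej M < nstates M \<and>
     qry M < nstates M \<and> qyes M < nstates M \<and> qno M < nstates M \<and>
     distinct [acc M, rej M, qry M] \<and>
     (\<forall>q a b. q < nstates M \<longrightarrow> fst (delta M q a b) < nstates M)"

definition no_oracle :: "otm \<Rightarrow> bool" where
  "no_oracle M \<longleftrightarrow> start M \<noteq> qry M \<and> (\<forall>q a b. fst (delta M q a b) \<noteq> qry M)"

record config =
  cstate :: nat
  wtape :: tape
  qtape :: tape

definition init_config :: "otm \<Rightarrow> bool list \<Rightarrow> config" where
  "init_config M x = \<lparr>cstate = start M, wtape = ([], map sym_of_bit x), qtape = ([], [])\<rparr>"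

definition step :: "bool list set \<Rightarrow> otm \<Rightarrow> config \<Rightarrow> config" where
  "step X M c =
     (if cstate c = acc M \<or> cstate c = rej M then c
      else if cstate c = qry M then
        c\<lparr>cstate := (if tape_word (qtape c) \<in> X then qyes M else qno M)\<rparr>
      else
        (case delta M (cstate c) (tape_read (wtape c)) (tape_read (qtape c)) of
           (q', w, mw, v, mv) \<Rightarrow>
             \<lparr>cstate = q',
              wtape = tape_move mw (tape_write w (wtape c)),
              qtape = tape_move mv (tape_write v (qtape c))\<rparr>))"

definition run :: "bool list set \<Rightarrow> otm \<Rightarrow> bool list \<Rightarrow> nat \<Rightarrow> config" where
  "run X M x n = (step X M ^^ n) (init_config M x)"

definition halts_at :: "bool list set \<Rightarrow> otm \<Rightarrow> bool list \<Rightarrow> nat \<Rightarrow> bool" where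
  "halts_at X M x n \<longleftrightarrow> cstate (run X M x n) = acc M \<or> cstate (run X M x n) = rej M"

definition time :: "bool list set \<Rightarrow> otm \<Rightarrow> bool list \<Rightarrow> nat" where
  "time X M x = (LEAST n. halts_at X M x n)"

definition decides_within :: "bool list set \<Rightarrow> otm \<Rightarrow> bool list set \<Rightarrow> (bool list \<Rightarrow> nat) \<Rightarrow> bool" where
  "decides_within X M L f \<longleftrightarrow> wf_otm M \<and>
     (\<forall>x. (\<exists>n. halts_at X M x n) \<and> time X M x \<le> f x \<and>
          (cstate (run X M x (time X M x)) = acc M \<longleftrightarrow> x \<in> L))"

definition decides :: "bool list set \<Rightarrow> otm \<Rightarrow> bool list set \<Rightarrow> bool" where
  "decides X M L \<longleftrightarrow> wf_otm M \<and>
     (\<forall>x. (\<exists>n. halts_at X M x n) \<and>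
          (cstate (run X M x (time X M x)) = acc M \<longleftrightarrow> x \<in> L))"

definition computable :: "bool list set \<Rightarrow> bool" where
  "computable L \<longleftrightarrow> (\<exists>M. no_oracle M \<and> decides {} M L)"

definition low_for_speed :: "bool list set \<Rightarrow> bool" where
  "low_for_speed X \<longleftrightarrow>
     (\<forall>L M f. computable L \<longrightarrow> decides_within X M L f \<longrightarrow>
        (\<exists>M' (p :: nat poly). no_oracle M' \<and> decides_within {} M' L (\<lambda>x. poly p (f x))))"

end

theory Submission
  imports Defs "HOL-Library.Countable_Set"
begin

text \<open>
  The oracle is \<open>X = {w. C |w|}\<close> for a generic \<open>C\<close> supported on the sparse set of
  positions \<open>2 ^ (j + 1) - 2\<close>, so that only polynomially many such \<open>C\<close> can be told apart by
  queries of length at most \<open>t\<close>.  Given a machine \<open>M\<close>, a language \<open>L\<close> and a finite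
  part of \<open>C\<close>, either some sparse continuation makes \<open>M\<close> halt with an answer that is wrong for
  \<open>L\<close>, and a finite part of it is adopted, or every halting computation of \<open>M\<close> with any sparse
  continuation is correct for \<open>L\<close>.  In the second case \<open>L\<close> is decided without oracle by trying
  all relevant continuations with growing time bounds and believing the first computation that halts;
  the true \<open>C\<close> is among the candidates, so this is polynomial in the running time of
  \<open>M\<close> with \<open>X\<close>, even when that is shorter than the input.  Since no effectiveness is needed
  in the choice of \<open>C\<close>, countably many requirements, including \<open>X \<noteq> L\<close> for computable
  \<open>L\<close>, are met one after the other.

  The candidates are enumerated by a binary counter that lives on the free cells of the simulating
  machine.  One cell is appended before every run, and it is free exactly when the
  counter has just overflowed; this yields the positions above, and the candidates of length
  \<open>t\<close> are exhausted after a number of runs linear in \<open>t\<close>.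
\<close>

section \<open>Tapes as functions\<close>

definition tape_at :: "tape \<Rightarrow> nat \<Rightarrow> symbol" where
  "tape_at t i = (let u = rev (fst t) @ snd t in if i < length u then u ! i else Bk)"

fun shift :: "move \<Rightarrow> nat \<Rightarrow> nat" where
  "shift MoveL h = h - 1"
| "shift MoveR h = Suc h"
| "shift Stay h = h"

lemma tape_read_eq: "tape_read t = tape_at t (length (fst t))"
  by (cases t rule: tape_read.cases) (auto simp: tape_at_def nth_append)

lemma tape_at_write: "tape_at (tape_write a t) = (tape_at t)(length (fst t) := a)"
  by (cases t rule: tape_read.cases) (auto simp: tape_at_def nth_append nth_Cons' fun_eq_iff)

lemma tape_at_move: "tape_at (tape_move m t) = tape_at t"
  by (cases "(m, t)" rule: tape_move.cases)
    (auto simp: tape_at_def nth_append nth_Cons' fun_eq_iff)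

lemma head_write: "length (fst (tape_write a t)) = length (fst t)"
  by (cases t rule: tape_read.cases) auto

lemma head_move: "length (fst (tape_move m t)) = shift m (length (fst t))"
  by (cases "(m, t)" rule: tape_move.cases) auto

text \<open>For an oracle that depends on word length only, the position of the first blank is all
  that matters about a query.\<close>

lemma length_tape_word: "length (tape_word t) = (LEAST i. tape_at t i = Bk)"
proof -
  define u where "u = rev (fst t) @ snd t"
  have at: "tape_at t i = (if i < length u then u ! i else Bk)" for i
    by (simp add: tape_at_def u_def)
  have "(LEAST i. tape_at t i = Bk) = length (takeWhile (\<lambda>a. a \<noteq> Bk) u)"
  proof (rule Least_equality)
    show "tape_at t (length (takeWhile (\<lambda>a. a \<noteq> Bk) u)) = Bk"
      using nth_length_takeWhile[of "\<lambda>a. a \<noteq> Bk" u] by (auto simp: at)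
  next
    fix i assume i: "tape_at t i = Bk"
    show "length (takeWhile (\<lambda>a. a \<noteq> Bk) u) \<le> i"
    proof (rule ccontr)
      assume "\<not> ?thesis"
      then have l: "i < length (takeWhile (\<lambda>a. a \<noteq> Bk) u)" by simp
      then have "takeWhile (\<lambda>a. a \<noteq> Bk) u ! i \<in> set (takeWhile (\<lambda>a. a \<noteq> Bk) u)"
        by (rule nth_mem)
      then have "takeWhile (\<lambda>a. a \<noteq> Bk) u ! i \<noteq> Bk" by (auto dest: set_takeWhileD)
      moreover have "i < length u"
        using l length_takeWhile_le[of "\<lambda>a. a \<noteq> Bk" u] by linarith
      ultimately show False using l i by (simp add: at takeWhile_nth)
    qed
  qed
  then show ?thesis by (simp add: tape_word_def u_def)
qed

section \<open>Configurations with total tapes, and oracles depending on length only\<close>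

definition input_tape :: "bool list \<Rightarrow> nat \<Rightarrow> symbol" where
  "input_tape x i = (if i < length x then sym_of_bit (x ! i) else Bk)"

type_synonym 's conf = "'s \<times> (nat \<Rightarrow> symbol) \<times> nat \<times> (nat \<Rightarrow> symbol) \<times> nat"

definition init_conf :: "'s \<Rightarrow> bool list \<Rightarrow> 's conf" where
  "init_conf s x = (s, input_tape x, 0, \<lambda>_. Bk, 0)"

definition conf_of :: "config \<Rightarrow> nat conf" where
  "conf_of c = (cstate c, tape_at (wtape c), length (fst (wtape c)),
     tape_at (qtape c), length (fst (qtape c)))"

lemma conf_of_init: "conf_of (init_config M x) = init_conf (start M) x"
  by (auto simp: conf_of_def init_config_def init_conf_def tape_at_def input_tape_def fun_eq_iff)

text \<open>A query becomes an ordinary transition that leaves symbols and heads in place; the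
  oracle enters only through \<open>ans\<close>.\<close>

definition act :: "otm \<Rightarrow> bool \<Rightarrow> nat \<Rightarrow> symbol \<Rightarrow> symbol \<Rightarrow> nat \<times> symbol \<times> move \<times> symbol \<times> move" where
  "act M ans s a b =
     (if s = qry M then (if ans then qyes M else qno M, a, Stay, b, Stay) else delta M s a b)"

definition tstep :: "('s \<Rightarrow> symbol \<Rightarrow> symbol \<Rightarrow> 's \<times> symbol \<times> move \<times> symbol \<times> move) \<Rightarrow> 's \<Rightarrow> 's \<Rightarrow> 's conf \<Rightarrow> 's conf" where
  "tstep D A R = (\<lambda>(s, W, h, Q, k). if s = A \<or> s = R then (s, W, h, Q, k) else
     (case D s (W h) (Q k) of (s', a, m, b, n) \<Rightarrow>
        (s', W(h := a), shift m h, Q(k := b), shift n k)))"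

definition ostep :: "(nat \<Rightarrow> bool) \<Rightarrow> otm \<Rightarrow> nat conf \<Rightarrow> nat conf" where
  "ostep B M = (\<lambda>(s, W, h, Q, k).
     tstep (act M (B (LEAST i. Q i = Bk))) (acc M) (rej M) (s, W, h, Q, k))"

lemma tstep_simp:
  "tstep D A R (s, W, h, Q, k) = (if s = A \<or> s = R then (s, W, h, Q, k) else
     (case D s (W h) (Q k) of (s', a, m, b, n) \<Rightarrow>
        (s', W(h := a), shift m h, Q(k := b), shift n k)))"
  by (simp add: tstep_def)

lemma ostep_simp:
  "ostep B M (s, W, h, Q, k) =
     tstep (act M (B (LEAST i. Q i = Bk))) (acc M) (rej M) (s, W, h, Q, k)"
  by (simp add: ostep_def)

definition length_oracle :: "(nat \<Rightarrow> bool) \<Rightarrow> bool list set" where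
  "length_oracle B = {w. B (length w)}"

lemma conf_of_step:
  "conf_of (step (length_oracle B) M c) = ostep B M (conf_of c)"
  by (auto simp: conf_of_def step_def ostep_def tstep_def act_def length_oracle_def
      length_tape_word tape_at_write tape_at_move head_write head_move tape_read_eq
      split: prod.split)

lemma conf_of_run:
  "conf_of (run (length_oracle B) M x n) = (ostep B M ^^ n) (init_conf (start M) x)"
  by (induction n) (simp_all add: run_def conf_of_init conf_of_step)

lemma cstate_run:
  "cstate (run (length_oracle B) M x n) = fst ((ostep B M ^^ n) (init_conf (start M) x))"
  using arg_cong[OF conf_of_run, of fst] by (simp add: conf_of_def)

lemma step_halted: "cstate c = acc M \<or> cstate c = rej M \<Longrightarrow> (step X M ^^ n) c = c"
  by (induction n) (auto simp: step_def)

text \<open>Halting configurations are fixed by \<open>step\<close>, so a verdict may be read off at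
  any later halting time, which also bounds \<open>time\<close> from above.\<close>

lemma run_time:
  assumes "halts_at X M x n"
  shows "time X M x \<le> n" "run X M x n = run X M x (time X M x)" "halts_at X M x (time X M x)"
proof -
  show le: "time X M x \<le> n" unfolding time_def by (rule Least_le[where P = "halts_at X M x", OF assms])
  show h: "halts_at X M x (time X M x)" unfolding time_def by (rule LeastI[where P = "halts_at X M x", OF assms])
  have "run X M x n = (step X M ^^ (n - time X M x + time X M x)) (init_config M x)"
    using le by (simp add: run_def)
  also have "\<dots> = (step X M ^^ (n - time X M x)) (run X M x (time X M x))"
    unfolding funpow_add run_def by simp
  also have "\<dots> = run X M x (time X M x)"
    by (rule step_halted) (use h in \<open>simp add: halts_at_def\<close>)
  finally show "run X M x n = run X M x (time X M x)" .
qed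

section \<open>Machines with an arbitrary finite set of states\<close>

text \<open>The states are numbered by a bijection; \<open>card S\<close> is an extra number serving
  as a query state that no transition enters.\<close>

lemma otm_of_finite_control:
  fixes D :: "'s \<Rightarrow> symbol \<Rightarrow> symbol \<Rightarrow> 's \<times> symbol \<times> move \<times> symbol \<times> move"
  assumes S: "finite S" "s0 \<in> S" "A \<in> S" "R \<in> S" "A \<noteq> R"
    and D: "\<And>s a b. s \<in> S \<Longrightarrow> fst (D s a b) \<in> S"
  obtains M where "wf_otm M" "no_oracle M"
    "\<And>x n. cstate (run {} M x n) = acc M \<longleftrightarrow> fst ((tstep D A R ^^ n) (init_conf s0 x)) = A"
    "\<And>x n. cstate (run {} M x n) = rej M \<longleftrightarrow> fst ((tstep D A R ^^ n) (init_conf s0 x)) = R"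
proof -
  obtain h where h: "bij_betw h S {0..<card S}"
    using ex_bij_betw_finite_nat[OF S(1)] by blast
  define g where "g = inv_into S h"
  have hS: "h s < card S" if "s \<in> S" for s using h that by (auto dest: bij_betwE)
  have gh: "g (h s) = s" if "s \<in> S" for s
    unfolding g_def using h that by (simp add: bij_betw_def)
  have g: "g q \<in> S" if "q < card S" for q
    unfolding g_def using h that by (intro inv_into_into) (simp add: bij_betw_def)
  have h_eq: "h s = h s' \<longleftrightarrow> s = s'" if "s \<in> S" "s' \<in> S" for s s'
    using that gh by metis
  define M where "M = \<lparr>nstates = Suc (card S),
     delta = \<lambda>q a b. if q < card S then apfst h (D (g q) a b) else (h A, Bk, Stay, Bk, Stay),
     start = h s0, acc = h A, rej = h R, qry = card S, qyes = h A, qno = h A\<rparr>"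
  have h_neq: "h s \<noteq> card S" "card S \<noteq> h s" if "s \<in> S" for s
    using hS[OF that] by auto
  have wf: "wf_otm M"
    using S D g hS h_neq h_eq by (auto simp: wf_otm_def M_def less_Suc_eq)
  have no: "no_oracle M"
    using S D g h_neq by (auto simp: no_oracle_def M_def)
  have empty_or: "{} = length_oracle (\<lambda>_. False)" by (auto simp: length_oracle_def)
  have inv: "(ostep (\<lambda>_. False) M ^^ n) (init_conf (start M) x) =
      apfst h ((tstep D A R ^^ n) (init_conf s0 x)) \<and> fst ((tstep D A R ^^ n) (init_conf s0 x)) \<in> S" for x n
  proof (induction n)
    case 0
    show ?case using S by (simp add: init_conf_def M_def)
  next
    case (Suc n)
    obtain s W i Q k where c: "(tstep D A R ^^ n) (init_conf s0 x) = (s, W, i, Q, k)"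
      by (metis prod_cases5)
    have s: "s \<in> S" and M: "(ostep (\<lambda>_. False) M ^^ n) (init_conf (start M) x) = (h s, W, i, Q, k)"
      using Suc c by auto
    obtain s' a m b n' where d: "D s (W i) (Q k) = (s', a, m, b, n')" by (metis prod_cases5)
    have "s' \<in> S" using D[OF s, of "W i" "Q k"] d by simp
    then have "ostep (\<lambda>_. False) M (h s, W, i, Q, k) = apfst h (tstep D A R (s, W, i, Q, k)) \<and>
        fst (tstep D A R (s, W, i, Q, k)) \<in> S"
      using s S hS[OF s] d gh[OF s]
      by (auto simp: ostep_simp tstep_simp act_def M_def h_eq)
    then show ?case by (simp add: c M)
  qed
  have st: "cstate (run {} M x n) = h (fst ((tstep D A R ^^ n) (init_conf s0 x)))" for x n
    unfolding empty_or cstate_run using inv by simp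
  show thesis
  proof (rule that[OF wf no])
    fix x n
    show "cstate (run {} M x n) = acc M \<longleftrightarrow> fst ((tstep D A R ^^ n) (init_conf s0 x)) = A"
      unfolding st using inv[of n x] S(3) by (simp add: h_eq M_def)
    show "cstate (run {} M x n) = rej M \<longleftrightarrow> fst ((tstep D A R ^^ n) (init_conf s0 x)) = R"
      unfolding st using inv[of n x] S(4) by (simp add: h_eq M_def)
  qed
qed

section \<open>Block machines\<close>

lemma UNIV_symbol: "(UNIV :: symbol set) = {Bk, S0, S1}"
  by (auto intro: symbol.exhaust)

lemma UNIV_move: "(UNIV :: move set) = {MoveL, MoveR, Stay}"
  by (auto intro: move.exhaust)

instance symbol :: finite
  by standard (simp add: UNIV_symbol)

instance move :: finite
  by standard (simp add: UNIV_move)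

type_synonym ('q, 'g) block_prog = "'q \<Rightarrow> 'g \<Rightarrow> symbol \<Rightarrow> 'q \<times> 'g \<times> move \<times> bool"
type_synonym ('q, 'g) block_conf = "'q \<times> (nat \<Rightarrow> 'g) \<times> nat \<times> nat"

definition gstep :: "('q, 'g) block_prog \<Rightarrow> 'q \<Rightarrow> 'q \<Rightarrow> (nat \<Rightarrow> symbol) \<Rightarrow>
    ('q, 'g) block_conf \<Rightarrow> ('q, 'g) block_conf" where
  "gstep P A R I = (\<lambda>(q, G, p, i). if q = A \<or> q = R then (q, G, p, i) else
     (case P q (G p) (I i) of (q', g, m, adv) \<Rightarrow>
        (q', G(p := g), shift m p, if adv then Suc i else i)))"

lemma gstep_simp:
  "gstep P A R I (q, G, p, i) = (if q = A \<or> q = R then (q, G, p, i) else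
     (case P q (G p) (I i) of (q', g, m, adv) \<Rightarrow>
        (q', G(p := g), shift m p, if adv then Suc i else i)))"
  by (simp add: gstep_def)

datatype 'q bstate = Rd 'q "symbol list" | Wr 'q move "symbol list" | Sk 'q move nat

text \<open>A block machine has one tape over an arbitrary finite alphabet and a one-way
  input head.  Its tape is coded in blocks of \<open>c\<close> symbols on the query tape; the input stays on the
  work tape, so nothing has to be paid for its length.  Reading a block rightwards (\<open>Rd\<close>), writing
  it back leftwards (\<open>Wr\<close>) and walking to the next block (\<open>Sk\<close>) take \<open>c\<close> steps
  each, whatever the move.  At the left end the truncation of \<open>shift\<close> agrees on both levels.\<close>

locale block_code =
  fixes P :: "('q, 'g) block_prog" and A R :: 'q
    and enc :: "'g \<Rightarrow> symbol list" and c :: nat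
  assumes len: "length (enc g) = c" and c0: "0 < c" and inj: "inj enc"
begin

fun D :: "'q bstate \<Rightarrow> symbol \<Rightarrow> symbol \<Rightarrow> 'q bstate \<times> symbol \<times> move \<times> symbol \<times> move" where
  "D (Rd q bs) a b =
     (if Suc (length bs) < c then (Rd q (bs @ [b]), a, Stay, b, MoveR)
      else (case P q (inv enc (bs @ [b])) a of (q', g, m, adv) \<Rightarrow>
        (Wr q' m (rev (enc g)), a, if adv then MoveR else Stay, b, Stay)))"
| "D (Wr q m vs) a b =
     (if length vs \<le> 1 then (Sk q m c, a, Stay, hd vs, Stay)
      else (Wr q m (tl vs), a, Stay, hd vs, MoveL))"
| "D (Sk q m k) a b = (if k \<le> 1 then Rd q [] else Sk q m (k - 1), a, Stay, b, m)"

definition flat :: "(nat \<Rightarrow> 'g) \<Rightarrow> nat \<Rightarrow> symbol" where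
  "flat G j = enc (G (j div c)) ! (j mod c)"

definition lift :: "(nat \<Rightarrow> symbol) \<Rightarrow> ('q, 'g) block_conf \<Rightarrow> 'q bstate conf" where
  "lift I = (\<lambda>(q, G, p, i). (Rd q [], I, i, flat G, c * p))"

abbreviation "lstep \<equiv> tstep D (Rd A []) (Rd R [])"

lemma flat_at: "j < c \<Longrightarrow> flat G (c * p + j) = enc (G p) ! j"
  using c0 by (simp add: flat_def)

lemma read_block:
  assumes "q \<noteq> A" "q \<noteq> R" "j < c"
  shows "(lstep ^^ j) (Rd q [], I, i, flat G, c * p) =
    (Rd q (take j (enc (G p))), I, i, flat G, c * p + j)"
  using assms(3)
proof (induction j)
  case (Suc j)
  have "take j (enc (G p)) @ [enc (G p) ! j] = take (Suc j) (enc (G p))"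
    using Suc.prems by (simp add: take_Suc_conv_app_nth len)
  moreover have "(flat G)(c * p + j := enc (G p) ! j) = flat G"
    using Suc.prems by (simp add: fun_upd_idem flat_at)
  ultimately show ?case
    using Suc assms(1,2) by (simp add: tstep_simp flat_at len)
qed simp

text \<open>Reading leaves the head on the last cell of the block, so the new code is written from
  right to left.\<close>

lemma write_block:
  assumes "j < c"
  shows "(lstep ^^ j) (Wr q m (rev (enc g)), I, i, flat G, c * p + c - 1) =
    (Wr q m (drop j (rev (enc g))), I, i,
     \<lambda>k. if c * p + c - j \<le> k \<and> k < c * p + c then enc g ! (k - c * p) else flat G k,
     c * p + c - 1 - j)"
  using assms
proof (induction j)
  case (Suc j)
  have hd: "hd (drop j (rev (enc g))) = enc g ! (c - Suc j)"
    using Suc.prems by (simp add: hd_drop_conv_nth rev_nth len)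
  show ?case
    using Suc
    by (auto simp: tstep_simp hd len drop_Suc tl_drop fun_eq_iff Suc_diff_Suc not_le)
qed (auto simp: fun_eq_iff)

lemma skip_block:
  assumes "j < c"
  shows "(lstep ^^ j) (Sk q m c, I, i, Q, p) = (Sk q m (c - j), I, i, Q, (shift m ^^ j) p)"
  using assms by (induction j) (auto simp: tstep_simp)

lemma shift_funpow: "(shift m ^^ j) k = (case m of MoveL \<Rightarrow> k - j | MoveR \<Rightarrow> k + j | Stay \<Rightarrow> k)"
  by (induction j) (auto split: move.splits)

text \<open>At \<open>p = 0\<close> a left move gives 0 on both sides, thanks to truncated
  subtraction.\<close>

lemma shift_block: "(shift m ^^ c) (c * p) = c * shift m p"
  by (cases m) (simp_all add: shift_funpow diff_mult_distrib2)

lemma funpow_mult3: "(f ^^ (3 * c)) x = f ((f ^^ (c - 1)) (f ((f ^^ (c - 1)) (f ((f ^^ (c - 1)) x)))))"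
proof -
  have *: "f ((f ^^ (c - 1)) y) = (f ^^ c) y" for y
    using c0 by (metis Suc_diff_1 comp_apply funpow.simps(2))
  have "3 * c = c + (c + c)" by simp
  then show ?thesis by (simp only: * funpow_add comp_apply)
qed

lemma halted_funpow: "f x = x \<Longrightarrow> (f ^^ n) x = x"
  by (induction n) auto

text \<open>Each phase consists of \<open>c - 1\<close> uniform steps and one step that passes to
  the next phase; \<open>P\<close> is consulted in the step that ends the reading. Halted
  configurations are fixed on both levels.\<close>

lemma emulate: "(lstep ^^ (3 * c)) (lift I C) = lift I (gstep P A R I C)"
proof -
  obtain q G p i where C: "C = (q, G, p, i)" by (metis prod_cases4)
  show ?thesis
  proof (cases "q = A \<or> q = R")
    case True
    then show ?thesis
      by (intro trans[OF halted_funpow]) (auto simp: C lift_def tstep_simp gstep_simp)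
  next
    case False
    obtain q' g m adv where d: "P q (G p) (I i) = (q', g, m, adv)" by (metis prod_cases4)
    define i' where "i' = (if adv then Suc i else i)"
    have r: "lstep ((lstep ^^ (c - 1)) (Rd q [], I, i, flat G, c * p)) =
        (Wr q' m (rev (enc g)), I, i', flat G, c * p + c - 1)"
    proof -
      have "take (c - 1) (enc (G p)) @ [enc (G p) ! (c - 1)] = enc (G p)"
        using c0 len[of "G p"] by (metis Suc_diff_1 lessI order_refl take_Suc_conv_app_nth take_all)
      moreover have "flat G (c * p + (c - 1)) = enc (G p) ! (c - 1)"
        using c0 by (intro flat_at) auto
      ultimately show ?thesis
        using False c0 inj d by (subst read_block) (auto simp: tstep_simp len i'_def)
    qed
    have w: "lstep ((lstep ^^ (c - 1)) (Wr q' m (rev (enc g)), I, i', flat G, c * p + c - 1)) =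
        (Sk q' m c, I, i', flat (G(p := g)), c * p)"
    proof -
      have hd: "hd (drop (c - Suc 0) (rev (enc g))) = enc g ! 0"
        using c0 by (simp add: hd_drop_conv_nth rev_nth len)
      have "enc (if k div c = p then g else G (k div c)) ! (k mod c) =
          (if k = c * p then enc g ! 0 else
            if Suc (c * p) \<le> k \<and> k < c * p + c then enc g ! (k - c * p) else flat G k)" for k
      proof (cases "k div c = p")
        case True
        then have "k = c * p + k mod c" by auto
        moreover have "k mod c < c" using c0 by simp
        ultimately show ?thesis using True by (smt (verit) add_diff_cancel_left' add_cancel_left_right le_add1 nat_add_left_cancel_less not_less_eq_eq le_antisym)
      next
        case False
        then have "\<not> (c * p \<le> k \<and> k < c * p + c)"
          by (metis add.commute div_nat_eqI mult.commute mult_Suc_right)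
        then show ?thesis using False c0 by (auto simp: flat_def)
      qed
      then show ?thesis
        using c0 by (subst write_block) (auto simp: tstep_simp hd len fun_eq_iff flat_def)
    qed
    have s: "lstep ((lstep ^^ (c - 1)) (Sk q' m c, I, i', flat (G(p := g)), c * p)) =
        (Rd q' [], I, i', flat (G(p := g)), c * shift m p)"
    proof -
      have "shift m ((shift m ^^ (c - 1)) (c * p)) = c * shift m p"
        using c0 shift_block[of m p] by (metis Suc_diff_1 comp_apply funpow.simps(2))
      then show ?thesis
        using c0 by (subst skip_block) (auto simp: tstep_simp)
    qed
    have "lift I C = (Rd q [], I, i, flat G, c * p)" by (simp add: C lift_def)
    moreover have "lift I (gstep P A R I C) = (Rd q' [], I, i', flat (G(p := g)), c * shift m p)"
      using False by (simp add: C lift_def gstep_simp d i'_def)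
    ultimately show ?thesis
      by (simp only: funpow_mult3 r w s)
  qed
qed

lemma emulate_run: "(lstep ^^ (3 * c * n)) (lift I C) = lift I ((gstep P A R I ^^ n) C)"
proof (induction n)
  case (Suc n)
  have "3 * c * Suc n = 3 * c + 3 * c * n" by simp
  then show ?case by (simp only: funpow_add comp_apply Suc emulate funpow.simps)
qed simp

end

lemma otm_of_block_machine:
  fixes P :: "('q, 'g :: finite) block_prog" and blank :: 'g
  assumes S: "finite S" "q0 \<in> S" "A \<in> S" "R \<in> S" "A \<noteq> R"
    and P: "\<And>q g a. q \<in> S \<Longrightarrow> fst (P q g a) \<in> S"
  obtains M K where "wf_otm M" "no_oracle M"
    "\<And>x n. cstate (run {} M x (K * n)) = acc M \<longleftrightarrow>
       fst ((gstep P A R (input_tape x) ^^ n) (q0, \<lambda>_. blank, 0, 0)) = A"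
    "\<And>x n. cstate (run {} M x (K * n)) = rej M \<longleftrightarrow>
       fst ((gstep P A R (input_tape x) ^^ n) (q0, \<lambda>_. blank, 0, 0)) = R"
proof -
  define c where "c = card (UNIV :: 'g set)"
  obtain idx :: "'g \<Rightarrow> nat" where idx: "bij_betw idx UNIV {0..<c}"
    unfolding c_def using ex_bij_betw_finite_nat[of "UNIV :: 'g set"] by auto
  have idx_less: "idx g < c" for g using idx by (auto dest: bij_betwE)
  \<comment> \<open>The letter \<open>blank\<close> is coded by blanks only, so that the empty query
    tape already codes the all-\<open>blank\<close> tape; any other letter has a single
    \<open>S1\<close> at its index.\<close>
  define enc where "enc g = map (\<lambda>i. if g \<noteq> blank \<and> i = idx g then S1 else Bk) [0..<c]" for g
  have nth: "enc g ! i = (if g \<noteq> blank \<and> i = idx g then S1 else Bk)" if "i < c" for g i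
    using that by (simp add: enc_def)
  have "inj enc"
  proof (rule injI)
    fix g g' assume "enc g = enc g'"
    then have "(g \<noteq> blank \<and> idx g'' = idx g) = (g' \<noteq> blank \<and> idx g'' = idx g')" for g''
      using nth[OF idx_less[of g''], of g] nth[OF idx_less[of g''], of g'] by (auto split: if_splits)
    then show "g = g'" using idx by (metis bij_betw_def injD)
  qed
  then interpret block_code P A R enc c
    by unfold_locales (auto simp: enc_def c_def card_gt_0_iff)
  let ?B = "{bs :: symbol list. length bs \<le> c}"
  define T where "T = case_prod Rd ` (S \<times> ?B) \<union> (\<lambda>(q, m, vs). Wr q m vs) ` (S \<times> UNIV \<times> ?B)
    \<union> (\<lambda>(q, m, k). Sk q m k) ` (S \<times> UNIV \<times> {..c})"
  have memT: "Rd q bs \<in> T \<longleftrightarrow> q \<in> S \<and> length bs \<le> c"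
    "Wr q m bs \<in> T \<longleftrightarrow> q \<in> S \<and> length bs \<le> c" "Sk q m k \<in> T \<longleftrightarrow> q \<in> S \<and> k \<le> c" for q m bs k
    by (auto simp: T_def image_iff)
  have "finite ?B" using finite_lists_length_le[of "UNIV :: symbol set" c] by simp
  then have T: "finite T" using S(1) unfolding T_def by auto
  have D: "fst (D s a b) \<in> T" if "s \<in> T" for s a b
  proof (cases s)
    case (Rd q bs)
    then have "fst (P q (inv enc (bs @ [b])) a) \<in> S" using that P by (simp add: memT)
    then show ?thesis using that Rd by (auto simp: memT len split: prod.split)
  qed (use that in \<open>auto simp: memT\<close>)
  obtain M where M: "wf_otm M" "no_oracle M"
    "\<And>x n. cstate (run {} M x n) = acc M \<longleftrightarrow>
       fst ((lstep ^^ n) (init_conf (Rd q0 []) x)) = Rd A []"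
    "\<And>x n. cstate (run {} M x n) = rej M \<longleftrightarrow>
       fst ((lstep ^^ n) (init_conf (Rd q0 []) x)) = Rd R []"
    by (rule otm_of_finite_control[of T "Rd q0 []" "Rd A []" "Rd R []" D])
      (use S T D in \<open>auto simp: memT\<close>)
  have init: "init_conf (Rd q0 []) x = lift (input_tape x) (q0, \<lambda>_. blank, 0, 0)" for x
    using c0 by (auto simp: init_conf_def lift_def flat_def nth fun_eq_iff)
  have fst_lift: "fst (lift I C) = Rd (fst C) []" for I C
    by (auto simp: lift_def split: prod.split)
  show thesis
    by (rule that[OF M(1,2), of "3 * c"]) (simp_all only: M(3,4) init emulate_run fst_lift bstate.inject simp_thms)
qed

section \<open>Sparse oracles read off a binary counter\<close>

definition sparse :: "nat \<Rightarrow> bool" where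
  "sparse i \<longleftrightarrow> (\<exists>j. i + 2 = 2 ^ Suc j)"

definition digit :: "nat \<Rightarrow> nat \<Rightarrow> bool" where
  "digit N i \<longleftrightarrow> (\<exists>j. i + 2 = 2 ^ Suc j \<and> bit N j)"

lemma digit_sparse: "digit N i \<Longrightarrow> sparse i"
  by (auto simp: digit_def sparse_def)

lemma pow2_minus_2: "(2 :: nat) ^ Suc j - 2 + 2 = 2 ^ Suc j"
proof -
  have "(1 :: nat) \<le> 2 ^ j" by simp
  then show ?thesis unfolding power_Suc by linarith
qed

lemma digit_pos: "digit N (2 ^ Suc j - 2) \<longleftrightarrow> bit N j"
  unfolding digit_def pow2_minus_2 by (metis nat.inject one_less_numeral_iff power_inject_exp semiring_norm(76))

text \<open>The carry of adding 1 reaches bit \<open>a\<close> iff all lower bits are 1; the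
  induction strips the lowest bit.\<close>

lemma bit_Suc_nat: "bit (Suc N) a \<longleftrightarrow> (bit N a \<noteq> (\<forall>b<a. bit N b))"
proof (induction a arbitrary: N)
  case (Suc a)
  have all: "(\<forall>b<Suc a. bit N b) \<longleftrightarrow> odd N \<and> (\<forall>b<a. bit (N div 2) b)"
    by (auto simp: All_less_Suc2 bit_0 bit_Suc)
  show ?case
    using Suc[of "N div 2"] by (cases "even N") (auto simp: all bit_Suc)
qed (simp add: bit_0)

lemma all_digits_below:
  "(\<forall>i<2 ^ Suc a - 2. sparse i \<longrightarrow> digit N i) \<longleftrightarrow> (\<forall>b<a. bit N b)"
proof safe
  fix b assume "\<forall>i<2 ^ Suc a - 2. sparse i \<longrightarrow> digit N i" "b < a"
  moreover have "(2 :: nat) ^ Suc b < 2 ^ Suc a" using \<open>b < a\<close> by simp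
  then have "2 ^ Suc b - 2 < (2 :: nat) ^ Suc a - 2"
    using pow2_minus_2[of a] pow2_minus_2[of b] by linarith
  ultimately have "digit N (2 ^ Suc b - 2)"
    unfolding sparse_def using pow2_minus_2[of b] by blast
  then show "bit N b" unfolding digit_pos .
next
  fix i assume b: "\<forall>b<a. bit N b" "i < 2 ^ Suc a - 2" "sparse i"
  then obtain j where j: "i + 2 = 2 ^ Suc j" by (auto simp: sparse_def)
  then have "(2 :: nat) ^ Suc j < 2 ^ Suc a" using b(2) by linarith
  then have "j < a" by simp
  then show "digit N i" using b(1) j by (auto simp: digit_def)
qed

text \<open>The increment in the form in which a single sweep performs it: a free cell flips iff the
  carry survived all free cells to its left.\<close>

lemma digit_Suc:
  assumes "sparse i"
  shows "digit (Suc N) i \<longleftrightarrow> (digit N i \<noteq> (\<forall>i'<i. sparse i' \<longrightarrow> digit N i'))"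
proof -
  obtain a where "i + 2 = 2 ^ Suc a" using assms by (auto simp: sparse_def)
  then have i: "i = 2 ^ Suc a - 2" by simp
  show ?thesis unfolding i all_digits_below digit_pos by (rule bit_Suc_nat)
qed

text \<open>The right-hand side says that incrementing \<open>n + 1\<close> carries out of the first
  \<open>n\<close> cells. Then all bits of \<open>n + 1\<close> are 1 up to the leading one, so
  \<open>n + 2\<close> is a power of two. The final carry thus tells the machine whether cell
  \<open>n\<close> is free.\<close>

lemma sparse_iff_all_digits: "sparse n \<longleftrightarrow> (\<forall>i<n. sparse i \<longrightarrow> digit (Suc n) i)"
proof
  assume "sparse n"
  then obtain a where a: "n + 2 = 2 ^ Suc a" by (auto simp: sparse_def)
  then have n: "n = 2 ^ Suc a - 2" by simp
  have "Suc n = mask (Suc a)" using a unfolding mask_eq_exp_minus_1 by linarith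
  then have "bit (Suc n) b" if "b < a" for b
    using that by (simp add: bit_mask_iff)
  then show "\<forall>i<n. sparse i \<longrightarrow> digit (Suc n) i"
    using all_digits_below[of a "Suc n"] unfolding n by blast
next
  assume *: "\<forall>i<n. sparse i \<longrightarrow> digit (Suc n) i"
  obtain a where a: "2 ^ a \<le> Suc n" "Suc n < 2 ^ Suc a"
    using ex_power_ivl1[of 2 "Suc n"] by auto
  have low: "bit (Suc n) b" if "b < a" for b
  proof -
    have "(2 :: nat) ^ Suc b \<le> 2 ^ a" using that by (intro power_increasing) auto
    moreover have "(1 :: nat) \<le> 2 ^ b" by simp
    ultimately have "2 ^ Suc b - 2 < n" using a(1) unfolding power_Suc by linarith
    then show ?thesis
      using * pow2_minus_2[of b] unfolding sparse_def digit_pos[symmetric] by blast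
  qed
  have "Suc n div 2 ^ a = 1"
    using a by (intro div_nat_eqI) auto
  then have top: "bit (Suc n) a" by (simp add: bit_iff_odd)
  have "mask (Suc a) = take_bit (Suc a) (Suc n)"
    by (rule bit_eqI) (use low top in \<open>auto simp: bit_mask_iff bit_take_bit_iff less_Suc_eq\<close>)
  also have "\<dots> = Suc n" using a(2) by (simp add: take_bit_nat_eq_self_iff del: power_Suc)
  finally have "n + 2 = 2 ^ Suc a"
    using a unfolding mask_eq_exp_minus_1 by linarith
  then show "sparse n" unfolding sparse_def by blast
qed

text \<open>An appended cell can always start with counter bit 0: if it is free, then
  \<open>n + 2 = 2 ^ (j + 1)\<close>, whose bit \<open>j\<close> is 0.\<close>

lemma new_digit_zero: "\<not> digit (Suc (Suc n)) n"
proof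
  assume "digit (Suc (Suc n)) n"
  then obtain j where j: "n + 2 = 2 ^ Suc j" "bit (Suc (Suc n)) j" by (auto simp: digit_def)
  have "bit (2 ^ Suc j :: nat) j" using j by (metis add_2_eq_Suc')
  then show False by (simp add: bit_exp_iff del: power_Suc)
qed

text \<open>The leading 1 above the \<open>k\<close> prescribed digits makes the run number
  large.\<close>

lemma exists_counter: "\<exists>N :: nat. 2 ^ k \<le> N \<and> N < 2 ^ Suc k \<and> (\<forall>j<k. bit N j = D j)"
proof (induction k arbitrary: D)
  case 0
  show ?case by (intro exI[of _ "1 :: nat"]) auto
next
  case (Suc k)
  from Suc[of "\<lambda>j. D (Suc j)"] obtain N :: nat
    where N: "2 ^ k \<le> N" "N < 2 ^ Suc k" "\<forall>j<k. bit N j = D (Suc j)" by blast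
  show ?case
  proof (intro exI[of _ "2 * N + of_bool (D 0)"] conjI allI impI)
    fix j assume "j < Suc k"
    then show "bit (2 * N + of_bool (D 0)) j = D j"
    proof (cases j)
      case (Suc j')
      have "(2 * N + of_bool (D 0)) div 2 = N" by simp
      then show ?thesis using N(3) Suc \<open>j < Suc k\<close> by (simp only: bit_Suc)
    qed (simp add: bit_0)
  next
    show "2 ^ Suc k \<le> 2 * N + of_bool (D 0)" using N(1) unfolding power_Suc by linarith
    show "2 * N + of_bool (D 0) < 2 ^ Suc (Suc k)" using N(2) unfolding power_Suc by (cases "D 0") simp_all
  qed
qed

text \<open>The candidate for run \<open>n\<close>: the given initial part \<open>B\<close> below \<open>m\<close>, then the
  binary digits of \<open>n + 1\<close>.\<close>

definition counter_oracle :: "(nat \<Rightarrow> bool) \<Rightarrow> nat \<Rightarrow> nat \<Rightarrow> nat \<Rightarrow> bool" where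
  "counter_oracle B m n i = (if i < m then B i else digit (Suc n) i)"

lemma counter_oracle_exhausts:
  assumes B: "\<And>i. C i \<Longrightarrow> sparse i" and "\<And>i. i < m \<Longrightarrow> C i = B i"
  shows "\<exists>n. t < n \<and> n \<le> 4 * t + 8 \<and> (\<forall>i\<le>t. counter_oracle B m n i = C i)"
proof -
  obtain k where k: "2 ^ k \<le> t + 2" "t + 2 < 2 ^ Suc k"
    using ex_power_ivl1[of 2 "t + 2"] by auto
  obtain N :: nat where N: "2 ^ Suc k \<le> N" "N < 2 ^ Suc (Suc k)"
      "\<forall>j<Suc k. bit N j = C (2 ^ Suc j - 2)"
    using exists_counter[of "Suc k" "\<lambda>j. C (2 ^ Suc j - 2)"] by blast
  show ?thesis
  \<comment> \<open>Run \<open>n\<close> uses the digits of \<open>n + 1\<close>, hence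
    \<open>N - 1\<close>. The prescribed digits cover all sparse positions up to \<open>t\<close>,
    and \<open>N < 2 ^ (k + 2) <= 4 * (t + 2)\<close>.\<close>
  proof (intro exI[of _ "N - 1"] conjI allI impI)
    fix i assume i: "i \<le> t"
    have "digit N i = C i"
    proof (cases "sparse i")
      case True
      then obtain j where j: "i + 2 = 2 ^ Suc j" by (auto simp: sparse_def)
      then have ij: "i = 2 ^ Suc j - 2" by simp
      have "(2 :: nat) ^ Suc j < 2 ^ Suc k" using i j k by linarith
      then have "j < Suc k" by simp
      then show ?thesis using N(3) unfolding ij digit_pos by blast
    qed (use B digit_sparse in blast)
    moreover have "Suc (N - 1) = N" using N(1) k(2) by linarith
    ultimately show "counter_oracle B m (N - 1) i = C i"
      using assms(2) by (simp add: counter_oracle_def)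
  next
    show "t < N - 1" using N(1) k(2) by linarith
    show "N - 1 \<le> 4 * t + 8" using N(2) k(1) unfolding power_Suc by linarith
  qed
qed

section \<open>The simulating program\<close>

text \<open>A cell holds an input symbol, the symbol and head mark of the simulated work tape, the same for
  the query tape, a mark that a simulated step uses up, whether the cell is free, and its counter bit.
  Between rounds the marks are \<open>Lt\<close> strictly left of the head and \<open>Gt\<close> elsewhere;
  a scan to the right turns the mark under the head into \<open>At\<close>, which lets the following scan to
  the left move the head in either direction.\<close>

datatype mark = Lt | At | Gt

datatype block = Lend | Blank | Cell symbol symbol mark symbol mark bool bool bool

lemma UNIV_mark: "(UNIV :: mark set) = {Lt, At, Gt}"
  by (auto intro: mark.exhaust)

instance mark :: finite
  by standard (simp add: UNIV_mark)

instance block :: finite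
proof
  have "(UNIV :: block set) \<subseteq> {Lend, Blank} \<union>
    (\<lambda>(x, w, wm, q, qm, t, f, b). Cell x w wm q qm t f b) `
      (UNIV \<times> UNIV \<times> UNIV \<times> UNIV \<times> UNIV \<times> UNIV \<times> UNIV \<times> UNIV)"
  proof
    fix g :: block
    show "g \<in> {Lend, Blank} \<union> (\<lambda>(x, w, wm, q, qm, t, f, b). Cell x w wm q qm t f b) `
      (UNIV \<times> UNIV \<times> UNIV \<times> UNIV \<times> UNIV \<times> UNIV \<times> UNIV \<times> UNIV)"
      by (cases g) (auto simp: image_iff)
  qed
  then show "finite (UNIV :: block set)"
    by (rule finite_subset) simp
qed

datatype pstate = Start | Reset bool | Back bool
  | Scan nat nat "symbol option" "symbol option" "bool option" bool
  | Write nat symbol move symbol move bool bool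
  | Accept | Reject

section \<open>Sweeps over the row of cells\<close>

definition row :: "nat \<Rightarrow> (nat \<Rightarrow> block) \<Rightarrow> nat \<Rightarrow> block" where
  "row n C i = (if i = 0 then Lend else if i \<le> n then C (i - 1) else Blank)"

lemma row_upd: "j < n \<Longrightarrow> (row n C)(Suc j := g) = row n (C(j := g))"
  by (auto simp: row_def fun_eq_iff)

lemma row_cong: "(\<And>j. j < n \<Longrightarrow> C j = C' j) \<Longrightarrow> row n C = row n C'"
  by (auto simp: row_def fun_eq_iff)

lemma sweep_right:
  assumes S: "\<And>j. j < n \<Longrightarrow> S j \<noteq> A \<and> S j \<noteq> R"
    and P: "\<And>j a. j < n \<Longrightarrow> P (S j) (C j) a = (S (Suc j), C' j, MoveR, False)"
  shows "(gstep P A R I ^^ n) (S 0, row n C, 1, i) = (S n, row n C', Suc n, i)"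
proof -
  have "k \<le> n \<Longrightarrow> (gstep P A R I ^^ k) (S 0, row n C, 1, i) =
      (S k, row n (\<lambda>j. if j < k then C' j else C j), Suc k, i)" for k
  proof (induction k)
    case (Suc k)
    have "row n (\<lambda>j. if j < k then C' j else C j) (Suc k) = C k"
      using Suc.prems by (simp add: row_def)
    then show ?case
      using Suc S[of k] P[of k "I i"]
      by (auto simp: gstep_simp row_upd intro!: row_cong)
  qed simp
  from this[of n] show ?thesis by (auto intro!: row_cong)
qed

text \<open>The row may be longer than the sweep: a reset has just appended a cell, and the way back
  starts to the left of it.\<close>

lemma sweep_left:
  assumes n: "n \<le> l" and S: "\<And>j. j \<le> n \<Longrightarrow> S j \<noteq> A \<and> S j \<noteq> R"
    and P: "\<And>j a. j < n \<Longrightarrow> P (S (Suc j)) (C j) a = (S j, C' j, MoveL, False)"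
  shows "(gstep P A R I ^^ n) (S n, row l C, n, i) =
    (S 0, row l (\<lambda>j. if j < n then C' j else C j), 0, i)"
proof -
  have "k \<le> n \<Longrightarrow> (gstep P A R I ^^ k) (S n, row l C, n, i) =
      (S (n - k), row l (\<lambda>j. if n - k \<le> j \<and> j < n then C' j else C j), n - k, i)" for k
  proof (induction k)
    case 0
    show ?case by (auto intro!: row_cong)
  next
    case (Suc k)
    define d where "d = n - Suc k"
    have d: "n - k = Suc d" "d < n" using Suc.prems by (auto simp: d_def)
    have "row l (\<lambda>j. if Suc d \<le> j \<and> j < n then C' j else C j) (Suc d) = C d"
      using n d by (simp add: row_def)
    then show ?case
      using Suc S[of "Suc d"] P[of d "I i"] n d
      by (auto simp: gstep_simp row_upd d_def[symmetric] intro!: row_cong)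
  qed
  from this[of n] show ?thesis by simp
qed

locale simulation =
  fixes M :: otm and m :: nat and B :: "nat \<Rightarrow> bool"
begin

abbreviation fresh :: "nat \<Rightarrow> pstate" where
  "fresh s \<equiv> Scan s 0 None None None False"

text \<open>\<open>Scan s i ao bo an tk\<close>: state of \<open>M\<close>, position capped at \<open>m\<close>, the symbols
  under the two heads and the answer to a query if already seen, and whether a time mark was found.
  The answer is found in the first cell whose query symbol is blank.  \<open>Back True\<close> returns to the left end
  after a timeout, \<open>Back False\<close> after a reset.\<close>

fun prog :: "(pstate, block) block_prog" where
  "prog (Reset cy) (Cell x w wm q qm t f b) a =
     (Reset (cy \<and> (f \<longrightarrow> b)), Cell x x Gt Bk Gt False f (f \<and> b \<noteq> cy), MoveR, False)"
| "prog (Reset cy) g a = (Back False, Cell a a Gt Bk Gt False cy False, MoveL, True)"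
| "prog (Back r) Lend a = (if r then Reset True else fresh (start M), Lend, MoveR, False)"
| "prog (Back r) g a = (Back r, g, MoveL, False)"
| "prog (Scan s i ao bo an tk) (Cell x w wm q qm t f b) a =
     (let hw = (ao = None \<and> wm = Gt); hq = (bo = None \<and> qm = Gt) in
      (Scan s (min m (Suc i)) (if hw then Some w else ao) (if hq then Some q else bo)
         (if an = None \<and> q = Bk then Some (if i < m then B i else b) else an) (tk \<or> \<not> t),
       Cell x w (if hw then At else wm) q (if hq then At else qm) (t \<or> \<not> tk) f b, MoveR, False))"
| "prog (Scan s i ao bo an tk) g a =
     (if s = acc M then (Accept, g, Stay, False)
      else if s = rej M then (Reject, g, Stay, False)
      else if \<not> tk then (Back True, g, MoveL, False)
      else (case act M (the an) s (the ao) (the bo) of (s', w', mw, q', mq) \<Rightarrow>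
        (Write s' w' mw q' mq False False, g, MoveL, False)))"
| "prog (Write s w' mw q' mq cw cq) (Cell x w wm q qm t f b) a =
     (Write s w' mw q' mq (wm = At \<and> mw = MoveL) (qm = At \<and> mq = MoveL),
      Cell x
        (if wm = At then w' else w)
        (if wm = At then if mw = MoveR then Lt else Gt else if cw then Gt else wm)
        (if qm = At then q' else q)
        (if qm = At then if mq = MoveR then Lt else Gt else if cq then Gt else qm)
        t f b, MoveL, False)"
| "prog (Write s w' mw q' mq cw cq) g a = (fresh s, g, MoveR, False)"
| "prog s g a = (Reset True, Lend, MoveR, False)"

text \<open>\<open>pstate\<close> is infinite only through machine states and positions; bounding
  these by \<open>nstates M\<close> and \<open>m\<close> leaves a finite set closed under
  \<open>prog\<close>.\<close>

fun ok :: "pstate \<Rightarrow> bool" where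
  "ok (Scan s i ao bo an tk) \<longleftrightarrow> s < nstates M \<and> i \<le> m"
| "ok (Write s w' mw q' mq cw cq) \<longleftrightarrow> s < nstates M"
| "ok _ \<longleftrightarrow> True"

lemma act_less:
  assumes "wf_otm M" "s < nstates M"
  shows "fst (act M an s a b) < nstates M"
  using assms by (auto simp: act_def wf_otm_def)

lemma ok_prog:
  assumes "wf_otm M" "ok q"
  shows "ok (fst (prog q g a))"
  using assms(2)
proof (induction q g a rule: prog.induct)
  case ("6_1" s i ao bo an tk a)
  then show ?case
    using act_less[OF assms(1), of s "the an" "the ao" "the bo"] by (auto split: prod.split)
next
  case ("6_2" s i ao bo an tk a)
  then show ?case
    using act_less[OF assms(1), of s "the an" "the ao" "the bo"] by (auto split: prod.split)
qed (use assms(1) in \<open>auto simp: wf_otm_def Let_def\<close>)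

lemma finite_ok: "finite {q. ok q}"
proof -
  have "{q. ok q} \<subseteq> {Start, Accept, Reject} \<union> range Reset \<union> range Back
    \<union> (\<lambda>(s, i, ao, bo, an, tk). Scan s i ao bo an tk) `
        ({..<nstates M} \<times> {..m} \<times> UNIV \<times> UNIV \<times> UNIV \<times> UNIV)
    \<union> (\<lambda>(s, w', mw, q', mq, cw, cq). Write s w' mw q' mq cw cq) `
        ({..<nstates M} \<times> UNIV \<times> UNIV \<times> UNIV \<times> UNIV \<times> UNIV \<times> UNIV)"
  proof
    fix q assume "q \<in> {q. ok q}"
    then show "q \<in> {Start, Accept, Reject} \<union> range Reset \<union> range Back
      \<union> (\<lambda>(s, i, ao, bo, an, tk). Scan s i ao bo an tk) `
        ({..<nstates M} \<times> {..m} \<times> UNIV \<times> UNIV \<times> UNIV \<times> UNIV)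
      \<union> (\<lambda>(s, w', mw, q', mq, cw, cq). Write s w' mw q' mq cw cq) `
        ({..<nstates M} \<times> UNIV \<times> UNIV \<times> UNIV \<times> UNIV \<times> UNIV \<times> UNIV)"
      by (cases q) (auto simp: image_iff)
  qed
  then show ?thesis
    by (rule finite_subset) simp
qed

end

section \<open>Rounds: one simulated step, halting, timeout and reset\<close>

definition first_blank :: "(nat \<Rightarrow> symbol) \<Rightarrow> nat \<Rightarrow> bool" where
  "first_blank Q z \<longleftrightarrow> Q z = Bk \<and> (\<forall>i<z. Q i \<noteq> Bk)"

lemma Least_blank: "first_blank Q z \<Longrightarrow> (LEAST i. Q i = Bk) = z"
  unfolding first_blank_def
  by (metis (mono_tags, lifting) LeastI linorder_neqE_nat not_less_Least)

text \<open>In a scan to the right the head is at the first \<open>Gt\<close>; a symbol already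
  stored tells that it has been passed.\<close>

lemma head_found:
  "(if (if h < j then Some (V h) else None) = None \<and> (if j < h then Lt else Gt) = Gt then Some (V j)
      else if h < j then Some (V h) else None) = (if h < Suc j then Some (V h) else None)"
  "(if (if h < j then Some (V h) else None) = None \<and> (if j < h then Lt else Gt) = Gt then At
      else if j < h then Lt else Gt) = (if j < h then Lt else if j = h then At else Gt)"
  for h j :: nat
  by (cases j h rule: linorder_cases; simp)+

text \<open>In the scan to the left \<open>At\<close> turns into \<open>Lt\<close> or
  \<open>Gt\<close>, and for \<open>MoveL\<close> the left neighbour becomes \<open>Gt\<close>. Cell
  0 has no such neighbour, in agreement with the truncated \<open>shift\<close>.\<close>

lemma head_moved:
  "(if (if j < h then Lt else if j = h then At else Gt) = At then v else V j) = (V(h := v)) j"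
  "(if (if j < h then Lt else if j = h then At else Gt) = At then if d = MoveR then Lt else Gt
      else if d = MoveL \<and> Suc j = h then Gt else if j < h then Lt else if j = h then At else Gt) =
    (if j < shift d h then Lt else Gt)"
  "(if j < h then Lt else if j = h then At else Gt) = At \<and> d = MoveL \<longleftrightarrow> d = MoveL \<and> j = h"
  for h j :: nat
  by (cases j h rule: linorder_cases; cases d; force)+

context simulation
begin

abbreviation go :: "(nat \<Rightarrow> symbol) \<Rightarrow> (pstate, block) block_conf \<Rightarrow> (pstate, block) block_conf" where
  "go I \<equiv> gstep prog Accept Reject I"

text \<open>After \<open>k\<close> steps \<open>k\<close> time marks are used up, so run
  \<open>n\<close> allows \<open>n\<close> steps. The input head is at \<open>n\<close> because each
  appended cell consumes one input symbol.\<close>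

fun stage :: "(nat \<Rightarrow> symbol) \<Rightarrow> nat \<Rightarrow> nat \<Rightarrow> nat conf \<Rightarrow> (pstate, block) block_conf" where
  "stage I n k (s, W, hw, Q, hq) = (fresh s,
     row n (\<lambda>j. Cell (I j) (W j) (if j < hw then Lt else Gt) (Q j) (if j < hq then Lt else Gt)
       (j < k) (sparse j) (digit (Suc n) j)), 1, n)"

text \<open>The row between the two scans: heads are marked and one more time mark is gone, hence
  \<open>j \<le> k\<close>.\<close>

fun marked :: "(nat \<Rightarrow> symbol) \<Rightarrow> nat \<Rightarrow> nat \<Rightarrow> nat conf \<Rightarrow> nat \<Rightarrow> block" where
  "marked I n k (s, W, hw, Q, hq) j = Cell (I j)
     (W j) (if j < hw then Lt else if j = hw then At else Gt)
     (Q j) (if j < hq then Lt else if j = hq then At else Gt)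
     (j \<le> k) (sparse j) (digit (Suc n) j)"

lemma scan_pass:
  assumes z: "first_blank Q z"
  shows "(go I ^^ n) (stage I n k (s, W, hw, Q, hq)) =
    (Scan s (min m n) (if hw < n then Some (W hw) else None) (if hq < n then Some (Q hq) else None)
       (if z < n then Some (counter_oracle B m n z) else None) (k < n),
     row n (marked I n k (s, W, hw, Q, hq)), Suc n, n)"
proof -
  have z: "Q z = Bk" "j < z \<Longrightarrow> Q j \<noteq> Bk" for j
    using z by (auto simp: first_blank_def)
  have mins: "min m (Suc (min m j)) = min m (Suc j)" for j
    by auto
  have ticks: "k < j \<or> \<not> j < k \<longleftrightarrow> k < Suc j" "j < k \<or> \<not> k < j \<longleftrightarrow> j \<le> k" for j
    by auto
  \<comment> \<open>The answer is found at cell \<open>z\<close>. The capped position suffices to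
    decide \<open>z < m\<close>, where \<open>B\<close> is built into the program; from
    \<open>m\<close> on the cell supplies its counter bit.\<close>
  have answer: "(if (if z < j then Some (counter_oracle B m n z) else None) = None \<and> Q j = Bk
      then Some (if min m j < m then B (min m j) else digit (Suc n) j)
      else if z < j then Some (counter_oracle B m n z) else None) =
    (if z < Suc j then Some (counter_oracle B m n z) else None)" for j
    using z(1) by (cases j z rule: linorder_cases)
      (auto simp: z(2) counter_oracle_def less_Suc_eq_le min_def)
  have "(go I ^^ n) ((\<lambda>j. Scan s (min m j) (if hw < j then Some (W hw) else None)
      (if hq < j then Some (Q hq) else None)
      (if z < j then Some (counter_oracle B m n z) else None) (k < j)) 0,
      row n (\<lambda>j. Cell (I j) (W j) (if j < hw then Lt else Gt) (Q j) (if j < hq then Lt else Gt)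
       (j < k) (sparse j) (digit (Suc n) j)), 1, n) =
    ((\<lambda>j. Scan s (min m j) (if hw < j then Some (W hw) else None)
      (if hq < j then Some (Q hq) else None)
      (if z < j then Some (counter_oracle B m n z) else None) (k < j)) n,
      row n (marked I n k (s, W, hw, Q, hq)), Suc n, n)"
  proof (rule sweep_right)
    fix j a assume "j < n"
    show "prog (Scan s (min m j) (if hw < j then Some (W hw) else None)
        (if hq < j then Some (Q hq) else None)
        (if z < j then Some (counter_oracle B m n z) else None) (k < j))
       (Cell (I j) (W j) (if j < hw then Lt else Gt) (Q j) (if j < hq then Lt else Gt)
         (j < k) (sparse j) (digit (Suc n) j)) a =
      (Scan s (min m (Suc j)) (if hw < Suc j then Some (W hw) else None)
        (if hq < Suc j then Some (Q hq) else None)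
        (if z < Suc j then Some (counter_oracle B m n z) else None) (k < Suc j),
       marked I n k (s, W, hw, Q, hq) j, MoveR, False)"
      by (simp only: prog.simps marked.simps Let_def mins ticks answer head_found)
  qed simp
  then show ?thesis by simp
qed

lemma write_pass:
  assumes "hw < n" "hq < n"
  shows "(go I ^^ n) (Write s' w mw q mq False False, row n (marked I n k (s, W, hw, Q, hq)), n, n) =
    (Write s' w mw q mq (mw = MoveL \<and> hw = 0) (mq = MoveL \<and> hq = 0),
     row n (\<lambda>j. Cell (I j) ((W(hw := w)) j) (if j < shift mw hw then Lt else Gt)
       ((Q(hq := q)) j) (if j < shift mq hq then Lt else Gt)
       (j \<le> k) (sparse j) (digit (Suc n) j)), 0, n)"
proof -
  have "(go I ^^ n) ((\<lambda>j. Write s' w mw q mq (mw = MoveL \<and> j = hw) (mq = MoveL \<and> j = hq)) n,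
      row n (marked I n k (s, W, hw, Q, hq)), n, n) =
    ((\<lambda>j. Write s' w mw q mq (mw = MoveL \<and> j = hw) (mq = MoveL \<and> j = hq)) 0,
     row n (\<lambda>j. if j < n then Cell (I j) ((W(hw := w)) j) (if j < shift mw hw then Lt else Gt)
       ((Q(hq := q)) j) (if j < shift mq hq then Lt else Gt)
       (j \<le> k) (sparse j) (digit (Suc n) j) else marked I n k (s, W, hw, Q, hq) j), 0, n)"
  proof (rule sweep_left)
    fix j a assume "j < n"
    show "prog (Write s' w mw q mq (mw = MoveL \<and> Suc j = hw) (mq = MoveL \<and> Suc j = hq))
       (marked I n k (s, W, hw, Q, hq) j) a =
      (Write s' w mw q mq (mw = MoveL \<and> j = hw) (mq = MoveL \<and> j = hq),
       Cell (I j) ((W(hw := w)) j) (if j < shift mw hw then Lt else Gt)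
       ((Q(hq := q)) j) (if j < shift mq hq then Lt else Gt)
       (j \<le> k) (sparse j) (digit (Suc n) j), MoveL, False)"
      by (simp only: prog.simps marked.simps head_moved)
  qed auto
  moreover have "row n (\<lambda>j. if j < n then X j else Y j) = row n X" for X Y
    by (rule row_cong) simp
  moreover have "n \<noteq> hw" "n \<noteq> hq" using assms by auto
  ultimately show ?thesis by (simp add: eq_commute[of 0])
qed

lemma funpow_pingpong: "(f ^^ (2 * n + 2)) x = f ((f ^^ n) (f ((f ^^ n) x)))"
proof -
  have "2 * n + 2 = Suc (n + Suc n)" by simp
  then show ?thesis by (simp only: funpow.simps funpow_add comp_apply)
qed

text \<open>Both heads and the end of the query word lie on the row, so the scan to the right
  collects all arguments of \<open>act\<close>.\<close>

lemma sim_round: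
  assumes "hw < n" "hq < n" "k < n" and z: "first_blank Q z" "z < n"
    and "s \<noteq> acc M" "s \<noteq> rej M"
  shows "(go I ^^ (2 * n + 2)) (stage I n k (s, W, hw, Q, hq)) =
    stage I n (Suc k) (ostep (counter_oracle B m n) M (s, W, hw, Q, hq))"
proof -
  obtain s' w mw q mq where a:
    "act M (counter_oracle B m n z) s (W hw) (Q hq) = (s', w, mw, q, mq)"
    by (metis prod_cases5)
  have blank: "row n C (Suc n) = Blank" for C by (simp add: row_def)
  have upd: "(row n C)(Suc n := Blank) = row n C" "(row n C)(0 := Lend) = row n C" for C
    by (auto simp: row_def)
  have lend: "row n C 0 = Lend" for C by (simp add: row_def)
  have "go I ((go I ^^ n) (stage I n k (s, W, hw, Q, hq))) =
      (Write s' w mw q mq False False, row n (marked I n k (s, W, hw, Q, hq)), n, n)"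
    using assms by (subst scan_pass[OF z(1)]) (auto simp: gstep_simp blank upd a)
  then show ?thesis
    using assms(6,7) unfolding funpow_pingpong
    by (simp add: write_pass[OF assms(1,2)] gstep_simp lend upd ostep_simp tstep_simp
        Least_blank[OF z(1)] a less_Suc_eq_le)
qed

lemma halt_round:
  assumes z: "first_blank Q z" and "s = acc M \<or> s = rej M"
  shows "fst ((go I ^^ Suc n) (stage I n k (s, W, hw, Q, hq))) =
    (if s = acc M then Accept else Reject)"
  using assms(2) by (elim disjE) (simp_all add: scan_pass[OF z] gstep_simp row_def del: stage.simps)

lemma back_pass:
  assumes "n \<le> l" "\<And>j. j < n \<Longrightarrow> C j \<noteq> Lend"
  shows "(go I ^^ n) (Back r, row l C, n, i) = (Back r, row l C, 0, i)"
proof -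
  have "(go I ^^ n) ((\<lambda>_. Back r) n, row l C, n, i) =
      ((\<lambda>_. Back r) 0, row l (\<lambda>j. if j < n then C j else C j), 0, i)"
  proof (rule sweep_left)
    fix j a assume "j < n"
    then show "prog (Back r) (C j) a = (Back r, C j, MoveL, False)"
      using assms(2)[of j] by (cases "C j") auto
  qed (use assms in auto)
  then show ?thesis by simp
qed

text \<open>The program tests for halting before it tests for time, so a run halting after exactly
  \<open>n\<close> steps is not lost.\<close>

lemma timeout_round:
  assumes z: "first_blank Q z" and "s \<noteq> acc M" "s \<noteq> rej M" "n \<le> k"
  shows "(go I ^^ (2 * n + 2)) (stage I n k (s, W, hw, Q, hq)) =
    (Reset True, row n (marked I n k (s, W, hw, Q, hq)), 1, n)"
proof -
  have upd: "(row n C)(Suc n := Blank) = row n C" "(row n C)(0 := Lend) = row n C" for C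
    by (auto simp: row_def)
  have lend: "row n C 0 = Lend" for C by (simp add: row_def)
  have "go I ((go I ^^ n) (stage I n k (s, W, hw, Q, hq))) =
      (Back True, row n (marked I n k (s, W, hw, Q, hq)), n, n)"
    using assms by (subst scan_pass[OF z(1)]) (auto simp: gstep_simp row_def)
  then show ?thesis
    unfolding funpow_pingpong
    by (simp add: back_pass gstep_simp upd lend)
qed

text \<open>One sweep increments the counter, restores the work tape and renews the time marks; its
  final carry decides whether the new cell is free. The row holds just \<open>n + 1\<close> input
  symbols, as many as \<open>n + 1\<close> steps can reach.\<close>

lemma reset_round:
  assumes C: "\<And>j. j < n \<Longrightarrow> \<exists>w wm q qm t. C j = Cell (I j) w wm q qm t (sparse j) (digit (Suc n) j)"
  shows "(go I ^^ (2 * n + 2)) (Reset True, row n C, 1, n) =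
    stage I (Suc n) 0 (start M, I, 0, \<lambda>_. Bk, 0)"
proof -
  let ?cy = "\<lambda>j. \<forall>i<j. sparse i \<longrightarrow> digit (Suc n) i"
  let ?C = "\<lambda>N j. Cell (I j) (I j) Gt Bk Gt False (sparse j) (digit N j)"
  have "(go I ^^ n) ((\<lambda>j. Reset (?cy j)) 0, row n C, 1, n) =
      ((\<lambda>j. Reset (?cy j)) n, row n (?C (Suc (Suc n))), Suc n, n)"
  proof (rule sweep_right)
    fix j a assume j: "j < n"
    then obtain w wm q qm t where Cj: "C j = Cell (I j) w wm q qm t (sparse j) (digit (Suc n) j)"
      using C by blast
    have "digit (Suc (Suc n)) j \<longleftrightarrow> sparse j \<and> digit (Suc n) j \<noteq> ?cy j"
      using digit_Suc[of j "Suc n"] digit_sparse[of "Suc (Suc n)" j] by blast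
    moreover have "?cy (Suc j) \<longleftrightarrow> ?cy j \<and> (sparse j \<longrightarrow> digit (Suc n) j)"
      by (auto simp: less_Suc_eq)
    ultimately show "prog (Reset (?cy j)) (C j) a =
        (Reset (?cy (Suc j)), ?C (Suc (Suc n)) j, MoveR, False)"
      unfolding Cj by (simp del: All_less_Suc)
  qed simp
  then have "(go I ^^ n) (Reset True, row n C, 1, n) =
      (Reset (sparse n), row n (?C (Suc (Suc n))), Suc n, n)"
    using sparse_iff_all_digits[of n] by simp
  moreover have "go I (Reset (sparse n), row n (?C (Suc (Suc n))), Suc n, n) =
      (Back False, row (Suc n) (?C (Suc (Suc n))), n, Suc n)"
    using new_digit_zero[of n] by (auto simp: gstep_simp row_def fun_eq_iff)
  moreover have "(row (Suc n) C)(0 := Lend) = row (Suc n) C" "row (Suc n) C 0 = Lend" for C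
    by (auto simp: row_def)
  ultimately show ?thesis
    unfolding funpow_pingpong by (simp add: back_pass gstep_simp)
qed

end

section \<open>Correctness and running time of the simulation\<close>

lemma conf_bounds:
  assumes "(ostep Y M ^^ k) (init_conf s0 x) = (s, W, hw, Q, hq)"
  shows "hw \<le> k \<and> hq \<le> k \<and> (\<forall>i\<ge>k. Q i = Bk)"
  using assms
proof (induction k arbitrary: s W hw Q hq)
  case 0
  then show ?case by (auto simp: init_conf_def)
next
  case (Suc k)
  obtain s1 W1 hw1 Q1 hq1 where c: "(ostep Y M ^^ k) (init_conf s0 x) = (s1, W1, hw1, Q1, hq1)"
    by (metis prod_cases5)
  have b: "hw1 \<le> k" "hq1 \<le> k" "\<forall>i\<ge>k. Q1 i = Bk" using Suc.IH[OF c] by auto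
  have shift: "shift d h \<le> Suc k" if "h \<le> k" for d h
    using that by (cases d) auto
  show ?case
    using Suc.prems b by (auto simp: c ostep_simp tstep_simp shift split: if_splits prod.splits)
qed

lemma conf_first_blank:
  assumes "(ostep Y M ^^ k) (init_conf s0 x) = (s, W, hw, Q, hq)"
  obtains z where "first_blank Q z" "z \<le> k"
proof
  have blank: "Q k = Bk" using conf_bounds[OF assms] by simp
  show "first_blank Q (LEAST i. Q i = Bk)"
    unfolding first_blank_def
    using LeastI[of "\<lambda>i. Q i = Bk", OF blank] not_less_Least[of _ "\<lambda>i. Q i = Bk"] by blast
  show "(LEAST i. Q i = Bk) \<le> k"
    by (rule Least_le) (rule blank)
qed

text \<open>The query word after \<open>j\<close> steps has length at most \<open>j\<close>, so
  \<open>k\<close> steps depend on the oracle below \<open>k\<close> only.\<close>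

lemma ostep_cong:
  assumes "\<And>i. i < k \<Longrightarrow> Y i = Z i"
  shows "(ostep Y M ^^ k) (init_conf s0 x) = (ostep Z M ^^ k) (init_conf s0 x)"
  using assms
proof (induction k)
  case (Suc k)
  obtain s W hw Q hq where c: "(ostep Y M ^^ k) (init_conf s0 x) = (s, W, hw, Q, hq)"
    by (metis prod_cases5)
  obtain z where z: "first_blank Q z" "z \<le> k" using conf_first_blank[OF c] .
  have "(ostep Z M ^^ k) (init_conf s0 x) = (s, W, hw, Q, hq)" using Suc c by simp
  then show ?case
    using Suc.prems c z by (simp add: ostep_simp Least_blank[OF z(1)])
qed simp

definition halted :: "otm \<Rightarrow> nat conf \<Rightarrow> bool" where
  "halted M c \<longleftrightarrow> fst c = acc M \<or> fst c = rej M"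

context simulation
begin

definition sim_conf :: "bool list \<Rightarrow> nat \<Rightarrow> nat \<Rightarrow> nat conf" where
  "sim_conf x n k = (ostep (counter_oracle B m n) M ^^ k) (init_conf (start M) x)"

lemma stage_run:
  assumes "k \<le> n" "\<And>k'. k' < k \<Longrightarrow> \<not> halted M (sim_conf x n k')"
  shows "(go I ^^ ((2 * n + 2) * k)) (stage I n 0 (sim_conf x n 0)) = stage I n k (sim_conf x n k)"
  using assms
proof (induction k)
  case (Suc k)
  obtain s W hw Q hq where c: "sim_conf x n k = (s, W, hw, Q, hq)" by (metis prod_cases5)
  obtain z where z: "first_blank Q z" "z \<le> k" using conf_first_blank c unfolding sim_conf_def .
  have b: "hw \<le> k" "hq \<le> k" using conf_bounds c unfolding sim_conf_def by blast+
  have s: "s \<noteq> acc M" "s \<noteq> rej M" using Suc.prems(2)[of k] c by (auto simp: halted_def)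
  have "(2 * n + 2) * Suc k = (2 * n + 2) + (2 * n + 2) * k" by simp
  then have "(go I ^^ ((2 * n + 2) * Suc k)) (stage I n 0 (sim_conf x n 0)) =
      (go I ^^ (2 * n + 2)) (stage I n k (sim_conf x n k))"
    using Suc by (simp only: funpow_add comp_apply) simp
  also have "\<dots> = stage I n (Suc k) (sim_conf x n (Suc k))"
    unfolding c using Suc.prems(1) b z s
    by (subst sim_round[of _ _ _ _ _ z]) (auto simp: c[unfolded sim_conf_def] sim_conf_def simp del: stage.simps)
  finally show ?case .
qed simp

lemma stage_halt:
  assumes "k \<le> n" "halted M (sim_conf x n k)"
  obtains T k' where "T \<le> (2 * n + 2) * (n + 1)" "halted M (sim_conf x n k')"
    "fst ((go I ^^ T) (stage I n 0 (sim_conf x n 0))) =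
       (if fst (sim_conf x n k') = acc M then Accept else Reject)"
proof -
  define k' where "k' = (LEAST k. halted M (sim_conf x n k))"
  have h: "halted M (sim_conf x n k')"
    unfolding k'_def by (rule LeastI[of "\<lambda>k. halted M (sim_conf x n k)", OF assms(2)])
  have "k' \<le> k" unfolding k'_def by (rule Least_le[of "\<lambda>k. halted M (sim_conf x n k)", OF assms(2)])
  then have k': "k' \<le> n" using assms(1) by simp
  have run: "(go I ^^ ((2 * n + 2) * k')) (stage I n 0 (sim_conf x n 0)) = stage I n k' (sim_conf x n k')"
    using k' by (rule stage_run) (auto simp: k'_def dest: not_less_Least)
  obtain s W hw Q hq where c: "sim_conf x n k' = (s, W, hw, Q, hq)" by (metis prod_cases5)
  obtain z where z: "first_blank Q z" "z \<le> k'" using conf_first_blank c unfolding sim_conf_def .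
  have "fst ((go I ^^ (Suc n + (2 * n + 2) * k')) (stage I n 0 (sim_conf x n 0))) =
      (if s = acc M then Accept else Reject)"
    unfolding funpow_add comp_apply run unfolding c
    by (rule halt_round[OF z(1)]) (use h c in \<open>simp add: halted_def\<close>)
  moreover have "Suc n + (2 * n + 2) * k' \<le> (2 * n + 2) * (n + 1)"
    using mult_le_mono2[OF k', of "2 * n + 2"] by simp
  ultimately show ?thesis using that[OF _ h] by (simp only: c fst_conv)
qed

lemma stage_next:
  assumes "\<And>k. k \<le> n \<Longrightarrow> \<not> halted M (sim_conf x n k)"
  shows "(go (input_tape x) ^^ ((2 * n + 2) * (n + 2))) (stage (input_tape x) n 0 (sim_conf x n 0)) =
    stage (input_tape x) (Suc n) 0 (sim_conf x (Suc n) 0)"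
proof -
  let ?I = "input_tape x"
  have run: "(go ?I ^^ ((2 * n + 2) * n)) (stage ?I n 0 (sim_conf x n 0)) = stage ?I n n (sim_conf x n n)"
    using assms by (intro stage_run) auto
  obtain s W hw Q hq where c: "sim_conf x n n = (s, W, hw, Q, hq)" by (metis prod_cases5)
  obtain z where z: "first_blank Q z" "z \<le> n" using conf_first_blank c unfolding sim_conf_def .
  have s: "s \<noteq> acc M" "s \<noteq> rej M" using assms[of n] c by (auto simp: halted_def)
  have "(2 * n + 2) * (n + 2) = (2 * n + 2) + ((2 * n + 2) + (2 * n + 2) * n)" by simp
  then have "(go ?I ^^ ((2 * n + 2) * (n + 2))) (stage ?I n 0 (sim_conf x n 0)) =
      (go ?I ^^ (2 * n + 2)) ((go ?I ^^ (2 * n + 2)) (stage ?I n n (sim_conf x n n)))"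
    by (simp only: funpow_add comp_apply run)
  also have "\<dots> = stage ?I (Suc n) 0 (start M, ?I, 0, \<lambda>_. Bk, 0)"
    unfolding c timeout_round[OF z(1) s order_refl]
    by (rule reset_round) (auto intro: exI[of _ True])
  finally show ?thesis by (simp add: sim_conf_def init_conf_def)
qed

lemma reach_stage:
  assumes "\<And>n' k. 1 \<le> n' \<Longrightarrow> n' \<le> n \<Longrightarrow> k \<le> n' \<Longrightarrow> \<not> halted M (sim_conf x n' k)"
  shows "\<exists>T \<le> 2 * (n + 2) ^ 3. (go (input_tape x) ^^ T) (Start, \<lambda>_. Blank, 0, 0) =
    stage (input_tape x) (Suc n) 0 (sim_conf x (Suc n) 0)"
  using assms
proof (induction n)
  case 0
  let ?I = "input_tape x"
  have "go ?I (Start, \<lambda>_. Blank, 0, 0) = (Reset True, row 0 (\<lambda>_. Blank), 1, 0)"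
    by (auto simp: gstep_simp row_def fun_eq_iff)
  then have "(go ?I ^^ (2 * 0 + 2 + 1)) (Start, \<lambda>_. Blank, 0, 0) =
      (go ?I ^^ (2 * 0 + 2)) (Reset True, row 0 (\<lambda>_. Blank), 1, 0)"
    unfolding funpow_add comp_apply by simp
  also have "\<dots> = stage ?I (Suc 0) 0 (start M, ?I, 0, \<lambda>_. Bk, 0)"
    by (rule reset_round) simp
  also have "(start M, ?I, 0, \<lambda>_. Bk, 0) = sim_conf x (Suc 0) 0"
    by (simp add: sim_conf_def init_conf_def)
  finally show ?case by (intro exI[of _ "2 * 0 + 2 + 1"] conjI) (simp_all add: power3_eq_cube)
next
  case (Suc n)
  let ?I = "input_tape x" and ?n = "Suc n"
  obtain T where T: "T \<le> 2 * (n + 2) ^ 3"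
    "(go ?I ^^ T) (Start, \<lambda>_. Blank, 0, 0) = stage ?I ?n 0 (sim_conf x ?n 0)"
    using Suc.IH Suc.prems by (metis le_SucI)
  have "(go ?I ^^ ((2 * ?n + 2) * (?n + 2) + T)) (Start, \<lambda>_. Blank, 0, 0) =
      stage ?I (Suc ?n) 0 (sim_conf x (Suc ?n) 0)"
    unfolding funpow_add comp_apply T(2) by (rule stage_next) (use Suc.prems in auto)
  \<comment> \<open>The cost of a run is quadratic and is absorbed by the difference of consecutive
    cubes.\<close>
  moreover have "(2 * ?n + 2) * (?n + 2) + 2 * (n + 2) ^ 3 \<le> 2 * (?n + 2) ^ 3"
    by (simp add: power3_eq_cube algebra_simps)
  then have "(2 * ?n + 2) * (?n + 2) + T \<le> 2 * (?n + 2) ^ 3" using T(1) by linarith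
  ultimately show ?case by blast
qed

text \<open>The program stops at the first run \<open>n0 \<le> n\<close> with a halting computation.
  Its candidate may differ from that of run \<open>n\<close>, but by \<open>L\<close> its verdict is
  right all the same.\<close>

lemma prog_correct:
  assumes n: "1 \<le> n" "k \<le> n" "halted M (sim_conf x n k)"
    and L: "\<And>n k. halted M (sim_conf x n k) \<Longrightarrow> fst (sim_conf x n k) = acc M \<longleftrightarrow> x \<in> L"
  shows "\<exists>T \<le> 2 * (n + 2) ^ 3. fst ((go (input_tape x) ^^ T) (Start, \<lambda>_. Blank, 0, 0)) =
    (if x \<in> L then Accept else Reject)"
proof -
  let ?I = "input_tape x"
  let ?P = "\<lambda>n. 1 \<le> n \<and> (\<exists>k\<le>n. halted M (sim_conf x n k))"
  define n0 where "n0 = (LEAST n. ?P n)"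
  have P: "?P n" using n by blast
  have P0: "?P n0" unfolding n0_def by (rule LeastI[of ?P, OF P])
  have le: "n0 \<le> n" unfolding n0_def by (rule Least_le[of ?P, OF P])
  obtain n1 where n1: "n0 = Suc n1" using P0 by (cases n0) auto
  have "\<exists>T \<le> 2 * (n1 + 2) ^ 3. (go ?I ^^ T) (Start, \<lambda>_. Blank, 0, 0) =
      stage ?I (Suc n1) 0 (sim_conf x (Suc n1) 0)"
  proof (rule reach_stage)
    fix n' k assume "1 \<le> n'" "n' \<le> n1" "k \<le> n'"
    moreover have "\<not> ?P n'" using \<open>n' \<le> n1\<close> n1 not_less_Least[of n' ?P] by (simp add: n0_def)
    ultimately show "\<not> halted M (sim_conf x n' k)" by blast
  qed
  then obtain T where T: "T \<le> 2 * (n1 + 2) ^ 3"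
    "(go ?I ^^ T) (Start, \<lambda>_. Blank, 0, 0) = stage ?I n0 0 (sim_conf x n0 0)"
    unfolding n1 by blast
  obtain k0 where "k0 \<le> n0" "halted M (sim_conf x n0 k0)" using P0 by blast
  then obtain T' k' where T': "T' \<le> (2 * n0 + 2) * (n0 + 1)" "halted M (sim_conf x n0 k')"
    "fst ((go ?I ^^ T') (stage ?I n0 0 (sim_conf x n0 0))) =
       (if fst (sim_conf x n0 k') = acc M then Accept else Reject)"
    by (rule stage_halt)
  have "fst ((go ?I ^^ (T' + T)) (Start, \<lambda>_. Blank, 0, 0)) = (if x \<in> L then Accept else Reject)"
    unfolding funpow_add comp_apply T(2) T'(3) using L[OF T'(2)] by simp
  moreover have "T' + T \<le> 2 * (n + 2) ^ 3"
  proof -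
    have "(2 * n0 + 2) * (n0 + 1) + 2 * (n1 + 2) ^ 3 \<le> 2 * (n0 + 2) ^ 3"
      unfolding n1 by (simp add: power3_eq_cube algebra_simps)
    also have "\<dots> \<le> 2 * (n + 2) ^ 3" using le by (intro mult_le_mono2 power_mono) auto
    finally show ?thesis using T(1) T'(1) by linarith
  qed
  ultimately show ?thesis by blast
qed

end

definition sparse_oracle :: "(nat \<Rightarrow> bool) \<Rightarrow> bool" where
  "sparse_oracle C \<longleftrightarrow> (\<forall>i. C i \<longrightarrow> sparse i)"

lemma halts_at_iff_halted:
  "halts_at (length_oracle C) M x t \<longleftrightarrow> halted M ((ostep C M ^^ t) (init_conf (start M) x))"
  by (simp add: halts_at_def halted_def cstate_run)

text \<open>Whichever candidate halts first is believed; therefore correctness is assumed for every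
  sparse continuation of \<open>B\<close> below \<open>m\<close>.\<close>

lemma simulator:
  assumes M: "wf_otm M" and B: "sparse_oracle B"
  obtains M' p where "wf_otm M'" "no_oracle M'"
    "\<And>L C f. (\<And>C x t. sparse_oracle C \<Longrightarrow> \<forall>i<m. C i = B i \<Longrightarrow> halts_at (length_oracle C) M x t \<Longrightarrow>
        cstate (run (length_oracle C) M x t) = acc M \<longleftrightarrow> x \<in> L) \<Longrightarrow>
      sparse_oracle C \<Longrightarrow> \<forall>i<m. C i = B i \<Longrightarrow> decides_within (length_oracle C) M L f \<Longrightarrow>
      decides_within {} M' L (\<lambda>x. poly p (f x))"
proof -
  interpret simulation M m B .
  obtain M' K where M': "wf_otm M'" "no_oracle M'"
    "\<And>x n. cstate (run {} M' x (K * n)) = acc M' \<longleftrightarrow>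
       fst ((go (input_tape x) ^^ n) (Start, \<lambda>_. Blank, 0, 0)) = Accept"
    "\<And>x n. cstate (run {} M' x (K * n)) = rej M' \<longleftrightarrow>
       fst ((go (input_tape x) ^^ n) (Start, \<lambda>_. Blank, 0, 0)) = Reject"
    by (rule otm_of_block_machine[of "{q. ok q}" Start Accept Reject prog Blank])
      (use finite_ok ok_prog[OF M] in auto)
  \<comment> \<open>From \<open>n \<le> 4 * t + 8\<close> follows
    \<open>n + 2 \<le> 4 * f x + 10\<close>; each program step costs \<open>K\<close> machine
    steps.\<close>
  define p where "p = smult (K * 2) ([:10, 4:] ^ 3)"
  have "decides_within {} M' L (\<lambda>x. poly p (f x))"
    if L: "\<And>C x t. sparse_oracle C \<Longrightarrow> \<forall>i<m. C i = B i \<Longrightarrow> halts_at (length_oracle C) M x t \<Longrightarrow>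
        cstate (run (length_oracle C) M x t) = acc M \<longleftrightarrow> x \<in> L"
      and C: "sparse_oracle C" "\<forall>i<m. C i = B i" and dec: "decides_within (length_oracle C) M L f"
    for L C f
    unfolding decides_within_def
  proof (intro conjI allI M'(1))
    fix x
    define t where "t = time (length_oracle C) M x"
    have t: "t \<le> f x" "halts_at (length_oracle C) M x t"
      using dec run_time(3) unfolding decides_within_def t_def by blast+
    obtain n where n: "t < n" "n \<le> 4 * t + 8" "\<forall>i\<le>t. counter_oracle B m n i = C i"
      using counter_oracle_exhausts[of C m B t] C by (auto simp: sparse_oracle_def)
    have Y: "sparse_oracle (counter_oracle B m n')" "\<forall>i<m. counter_oracle B m n' i = B i" for n'
      using B by (auto simp: sparse_oracle_def counter_oracle_def digit_sparse)
    have "sim_conf x n t = (ostep C M ^^ t) (init_conf (start M) x)"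
      unfolding sim_conf_def by (rule ostep_cong) (use n(3) in auto)
    then have h: "halted M (sim_conf x n t)" using t(2) by (simp add: halts_at_iff_halted)
    have correct: "fst (sim_conf x n k) = acc M \<longleftrightarrow> x \<in> L" if "halted M (sim_conf x n k)" for n k
      using L[OF Y, of n x k] that unfolding halts_at_iff_halted cstate_run sim_conf_def .
    obtain T where T: "T \<le> 2 * (n + 2) ^ 3" "fst ((go (input_tape x) ^^ T) (Start, \<lambda>_. Blank, 0, 0)) =
        (if x \<in> L then Accept else Reject)"
      using prog_correct[of n t x L] n(1) h correct by auto
    have halts: "halts_at {} M' x (K * T)"
      using T(2) unfolding halts_at_def M'(3,4) by simp
    then show "\<exists>n. halts_at {} M' x n" ..
    have "K * T \<le> K * (2 * (n + 2) ^ 3)" using T(1) by simp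
    also have "\<dots> \<le> K * (2 * (4 * f x + 10) ^ 3)"
      using n(2) t(1) by (intro mult_le_mono2 power_mono) auto
    also have "\<dots> = poly p (f x)" by (simp add: p_def algebra_simps)
    finally show "time {} M' x \<le> poly p (f x)" using run_time(1)[OF halts] by simp
    show "cstate (run {} M' x (time {} M' x)) = acc M' \<longleftrightarrow> x \<in> L"
      unfolding run_time(2)[OF halts, symmetric] M'(3) using T(2) by simp
  qed
  with M'(1,2) show ?thesis by (rule that)
qed

section \<open>Countably many requirements\<close>

text \<open>There are uncountably many \<open>otm\<close> records, because \<open>delta\<close> is arbitrary on numbers
  that are not states.\<close>

definition restrict_delta :: "otm \<Rightarrow> otm" where
  "restrict_delta M = M\<lparr>delta := \<lambda>q a b. if q < nstates M then delta M q a b else (0, Bk, Stay, Bk, Stay)\<rparr>"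

lemma run_restrict_delta:
  assumes "wf_otm M"
  shows "run X (restrict_delta M) x n = run X M x n \<and> cstate (run X M x n) < nstates M"
proof (induction n)
  case 0
  show ?case using assms by (simp add: run_def init_config_def restrict_delta_def wf_otm_def)
next
  case (Suc n)
  define c where "c = run X M x n"
  have c: "run X (restrict_delta M) x n = c" "cstate c < nstates M" using Suc by (auto simp: c_def)
  have "step X (restrict_delta M) c = step X M c"
    using c(2) by (simp add: step_def restrict_delta_def)
  moreover have "cstate (step X M c) < nstates M"
    using assms c(2) by (auto simp: step_def wf_otm_def split: prod.split) (metis fst_conv)
  moreover have "run X M' x (Suc n) = step X M' (run X M' x n)" for M' by (simp add: run_def)
  ultimately show ?case by (simp add: c c_def[symmetric])
qed

lemma decides_within_restrict_delta:
  assumes "wf_otm M"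
  shows "decides_within X (restrict_delta M) L f \<longleftrightarrow> decides_within X M L f"
proof -
  have "wf_otm (restrict_delta M)" using assms by (simp add: wf_otm_def restrict_delta_def)
  moreover have "halts_at X (restrict_delta M) = halts_at X M"
    using run_restrict_delta[OF assms] by (auto simp: halts_at_def restrict_delta_def fun_eq_iff)
  moreover have "acc (restrict_delta M) = acc M" by (simp add: restrict_delta_def)
  ultimately show ?thesis
    using assms run_restrict_delta[OF assms] by (simp add: decides_within_def time_def)
qed

text \<open>A restricted machine is determined by finitely many numbers and the finite table of
  \<open>delta\<close> on its own states.\<close>

lemma countable_restricted: "countable (range restrict_delta)"
proof -
  define code where "code M = (nstates M, start M, acc M, rej M, qry M, qyes M, qno M,
    map (\<lambda>(q, a, b). delta M q a b)
      (List.product [0..<nstates M] (List.product [Bk, S0, S1] [Bk, S0, S1])))" for M :: otm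
  have "restrict_delta M = restrict_delta M'" if "code M = code M'" for M M'
  proof (cases M, cases M')
    fix n d s a r q y o' n' d' s' a' r' q' y' o''
    assume M: "M = \<lparr>nstates = n, delta = d, start = s, acc = a, rej = r, qry = q, qyes = y, qno = o'\<rparr>"
      and M': "M' = \<lparr>nstates = n', delta = d', start = s', acc = a', rej = r', qry = q', qyes = y', qno = o''\<rparr>"
    have d: "d p b c = d' p b c" if "p < n" for p b c
    proof -
      have "(p, b, c) \<in> set (List.product [0..<n] (List.product [Bk, S0, S1] [Bk, S0, S1]))"
        using that by (cases b; cases c) auto
      then show ?thesis using \<open>code M = code M'\<close>
        unfolding code_def M M' by (auto simp: map_eq_conv simp del: product.simps set_product)
    qed
    then show ?thesis using \<open>code M = code M'\<close>
      by (auto simp: code_def M M' restrict_delta_def fun_eq_iff)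
  qed
  then have "restrict_delta M = (restrict_delta \<circ> inv code) (code M)" for M
    by (metis comp_apply f_inv_into_f rangeI)
  then have "range restrict_delta \<subseteq> range (restrict_delta \<circ> inv code)" by blast
  then show ?thesis by (rule countable_subset) simp
qed

lemma countable_computable: "countable {L. computable L}"
proof -
  define lang where "lang M = {x. cstate (run {} M x (time {} M x)) = acc M}" for M
  have "L \<in> lang ` range restrict_delta" if "computable L" for L
  proof -
    obtain M where M: "wf_otm M" "\<And>x. cstate (run {} M x (time {} M x)) = acc M \<longleftrightarrow> x \<in> L"
      using \<open>computable L\<close> by (auto simp: computable_def decides_def)
    have "time {} (restrict_delta M) x = time {} M x" for x
      using run_restrict_delta[OF M(1)] by (simp add: time_def halts_at_def restrict_delta_def)
    then have "lang (restrict_delta M) = L"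
      using M(2) run_restrict_delta[OF M(1)] by (auto simp: lang_def restrict_delta_def)
    then show ?thesis by blast
  qed
  then have "{L. computable L} \<subseteq> lang ` range restrict_delta" by blast
  then show ?thesis by (rule countable_subset) (intro countable_image countable_restricted)
qed

section \<open>Generic oracles\<close>

text \<open>Forcing with finite conditions: the condition is the part of \<open>B\<close> below
  \<open>m\<close>, and \<open>B\<close> is one sparse continuation of it.\<close>

definition forced :: "((nat \<Rightarrow> bool) \<Rightarrow> bool) \<Rightarrow> nat \<Rightarrow> (nat \<Rightarrow> bool) \<Rightarrow> bool" where
  "forced G m B \<longleftrightarrow> (\<forall>C. sparse_oracle C \<longrightarrow> (\<forall>i<m. C i = B i) \<longrightarrow> G C)"

text \<open>Requiring \<open>m < m'\<close> makes the conditions of a chain grow past every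
  position.\<close>

definition dense :: "((nat \<Rightarrow> bool) \<Rightarrow> bool) \<Rightarrow> bool" where
  "dense G \<longleftrightarrow> (\<forall>B m. sparse_oracle B \<longrightarrow>
     (\<exists>B' m'. sparse_oracle B' \<and> m < m' \<and> (\<forall>i<m. B' i = B i) \<and> forced G m' B'))"

lemma generic_sequence:
  fixes G :: "nat \<Rightarrow> (nat \<Rightarrow> bool) \<Rightarrow> bool"
  assumes "\<And>k. dense (G k)"
  shows "\<exists>C. \<forall>k. G k C"
proof -
  define P where "P k c c' \<longleftrightarrow> snd c < snd c' \<and> (\<forall>i<snd c. fst c' i = fst c i) \<and>
    forced (G k) (snd c') (fst c')" for k and c c' :: "(nat \<Rightarrow> bool) \<times> nat"
  have "\<exists>f. \<forall>k. sparse_oracle (fst (f k)) \<and> P k (f k) (f (Suc k))"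
  proof (rule dependent_nat_choice)
    show "\<exists>c :: (nat \<Rightarrow> bool) \<times> nat. sparse_oracle (fst c)"
      by (rule exI[of _ "(\<lambda>_. False, 0)"]) (simp add: sparse_oracle_def)
  next
    fix c :: "(nat \<Rightarrow> bool) \<times> nat" and k assume "sparse_oracle (fst c)"
    then obtain B m where "sparse_oracle B" "snd c < m" "\<forall>i<snd c. B i = fst c i" "forced (G k) m B"
      using assms unfolding dense_def by blast
    then show "\<exists>c'. sparse_oracle (fst c') \<and> P k c c'"
      by (intro exI[of _ "(B, m)"]) (simp add: P_def)
  qed
  then obtain f where f: "\<And>k. sparse_oracle (fst (f k))" "\<And>k. snd (f k) < snd (f (Suc k))"
    "\<And>k. \<forall>i<snd (f k). fst (f (Suc k)) i = fst (f k) i"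
    "\<And>k. forced (G k) (snd (f (Suc k))) (fst (f (Suc k)))"
    unfolding P_def by blast
  have ge: "k \<le> snd (f k)" for k
  proof (induction k)
    case (Suc k)
    then show ?case using f(2)[of k] by simp
  qed simp
  have mono: "snd (f k) \<le> snd (f l) \<and> (\<forall>i<snd (f k). fst (f l) i = fst (f k) i)" if "k \<le> l" for k l
    using that
  proof (induction l rule: dec_induct)
    case (step l)
    have "snd (f l) \<le> snd (f (Suc l))" using f(2)[of l] by simp
    then show ?case using step.IH f(3)[of l] by (meson order_less_le_trans order_trans)
  qed simp
  \<comment> \<open>The condition reached at index \<open>i + 1\<close> has length above
    \<open>i\<close>, so the value at \<open>i\<close> is settled there.\<close>
  define C where "C i = fst (f (Suc i)) i" for i
  have agree: "C i = fst (f k) i" if i: "i < snd (f k)" for i k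
  proof (cases "k \<le> Suc i")
    case True
    then show ?thesis using mono i by (simp add: C_def)
  next
    case False
    moreover have "i < snd (f (Suc i))" using ge[of "Suc i"] by simp
    ultimately show ?thesis using mono[of "Suc i" k] by (simp add: C_def)
  qed
  have C: "sparse_oracle C" using f(1) by (auto simp: sparse_oracle_def C_def)
  have "G k C" for k
    using f(4)[of k] C agree unfolding forced_def by blast
  then show ?thesis by blast
qed

lemma generic_oracle:
  assumes "countable \<G>" "\<And>G. G \<in> \<G> \<Longrightarrow> dense G"
  shows "\<exists>C. \<forall>G\<in>\<G>. G C"
proof (cases "\<G> = {}")
  case False
  then have "dense (from_nat_into \<G> k)" for k by (intro assms(2) from_nat_into)
  then obtain C where "\<forall>k. from_nat_into \<G> k C" using generic_sequence by blast
  then show ?thesis using from_nat_into_surj[OF assms(1)] by metis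
qed simp

text \<open>Diagonalisation at a word of zeros whose length is a sparse position beyond the
  condition; \<open>m < 2 ^ m\<close> places it there.\<close>

lemma dense_avoid: "dense (\<lambda>C. length_oracle C \<noteq> L)"
  unfolding dense_def
proof (intro allI impI)
  fix B m assume B: "sparse_oracle B"
  define i :: nat where "i = 2 ^ Suc m - 2"
  have "i + 2 = 2 ^ Suc m" unfolding i_def by (rule pow2_minus_2)
  then have i: "sparse i" by (auto simp: sparse_def simp del: power_Suc)
  have "m < 2 ^ m" by (rule less_exp)
  then have "m \<le> i" using \<open>i + 2 = 2 ^ Suc m\<close> unfolding power_Suc by linarith
  let ?B = "B(i := replicate i False \<notin> L)"
  have "forced (\<lambda>C. length_oracle C \<noteq> L) (Suc i) ?B"
    unfolding forced_def
  proof (intro allI impI)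
    fix C assume "\<forall>j<Suc i. C j = ?B j"
    then have "C i \<longleftrightarrow> replicate i False \<notin> L" by simp
    then show "length_oracle C \<noteq> L" by (auto simp: length_oracle_def)
  qed
  moreover have "sparse_oracle ?B" using B i by (simp add: sparse_oracle_def)
  ultimately show "\<exists>B' m'. sparse_oracle B' \<and> m < m' \<and> (\<forall>j<m. B' j = B j) \<and>
      forced (\<lambda>C. length_oracle C \<noteq> L) m' B'"
    using \<open>m \<le> i\<close> by (intro exI[of _ ?B] exI[of _ "Suc i"]) auto
qed

definition fast :: "bool list set \<Rightarrow> (bool list \<Rightarrow> nat) \<Rightarrow> bool" where
  "fast L f \<longleftrightarrow> (\<exists>M' (p :: nat poly). no_oracle M' \<and> decides_within {} M' L (\<lambda>x. poly p (f x)))"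

lemma dense_fast:
  assumes M: "wf_otm M"
  shows "dense (\<lambda>C. \<forall>f. decides_within (length_oracle C) M L f \<longrightarrow> fast L f)"
  unfolding dense_def
proof (intro allI impI)
  fix B m assume B: "sparse_oracle B"
  let ?G = "\<lambda>C. \<forall>f. decides_within (length_oracle C) M L f \<longrightarrow> fast L f"
  let ?acc = "\<lambda>C x t. cstate (run (length_oracle C) M x t) = acc M"
  show "\<exists>B' m'. sparse_oracle B' \<and> m < m' \<and> (\<forall>i<m. B' i = B i) \<and> forced ?G m' B'"
  proof (cases "\<exists>C x t. sparse_oracle C \<and> (\<forall>i<m. C i = B i) \<and> halts_at (length_oracle C) M x t \<and>
      \<not> (?acc C x t \<longleftrightarrow> x \<in> L)")
    case True
    then obtain C x t where C: "sparse_oracle C" "\<forall>i<m. C i = B i" "halts_at (length_oracle C) M x t"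
      and wrong: "\<not> (?acc C x t \<longleftrightarrow> x \<in> L)" by blast
    \<comment> \<open>The wrong computation sees the oracle below \<open>t\<close> only, so it
      persists, and the requirement holds vacuously.\<close>
    have "forced ?G (Suc (max m t)) C"
      unfolding forced_def
    proof (intro allI impI)
      fix D f assume D: "\<forall>i<Suc (max m t). D i = C i" and dec: "decides_within (length_oracle D) M L f"
      have eq: "(ostep D M ^^ t) (init_conf (start M) x) = (ostep C M ^^ t) (init_conf (start M) x)"
        by (rule ostep_cong) (use D in auto)
      then have "halts_at (length_oracle D) M x t" using C(3) by (simp add: halts_at_iff_halted)
      then have "?acc D x t \<longleftrightarrow> x \<in> L" using dec run_time(2) by (metis decides_within_def)
      then show "fast L f" using wrong eq by (simp add: cstate_run)
    qed
    then show ?thesis using C by (intro exI[of _ C] exI[of _ "Suc (max m t)"]) auto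
  next
    case False
    obtain M' p where M': "wf_otm M'" "no_oracle M'"
      "\<And>L C f. (\<And>C x t. sparse_oracle C \<Longrightarrow> \<forall>i<m. C i = B i \<Longrightarrow>
          halts_at (length_oracle C) M x t \<Longrightarrow> ?acc C x t \<longleftrightarrow> x \<in> L) \<Longrightarrow>
        sparse_oracle C \<Longrightarrow> \<forall>i<m. C i = B i \<Longrightarrow> decides_within (length_oracle C) M L f \<Longrightarrow>
        decides_within {} M' L (\<lambda>x. poly p (f x))"
      by (rule simulator[OF M B, where m = m]) blast
    \<comment> \<open>Every continuation already meets the requirement; \<open>Suc m\<close> only
      serves the strict growth in \<open>dense\<close>.\<close>
    have "forced ?G (Suc m) B"
      unfolding forced_def
    proof (intro allI impI)
      fix C f assume "sparse_oracle C" "\<forall>i<Suc m. C i = B i" "decides_within (length_oracle C) M L f"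
      then have "decides_within {} M' L (\<lambda>x. poly p (f x))"
        using False by (intro M'(3)) auto
      with M'(2) show "fast L f" unfolding fast_def by blast
    qed
    then show ?thesis using B by (intro exI[of _ B] exI[of _ "Suc m"]) auto
  qed
qed

theorem theorem2p1:
  shows "\<exists>X. \<not> computable X \<and> low_for_speed X"
proof -
  define avoid where "avoid = (\<lambda>L C. length_oracle C \<noteq> L)"
  \<comment> \<open>There are uncountably many bounds \<open>f\<close>, so they are quantified
    inside a requirement; the indices \<open>M\<close> and \<open>L\<close> range over countable
    sets.\<close>
  define speed where "speed = (\<lambda>(M, L) C. \<forall>f. decides_within (length_oracle C) M L f \<longrightarrow> fast L f)"
  let ?MM = "{M \<in> range restrict_delta. wf_otm M}" and ?LL = "{L. computable L}"
  have "countable ?MM" by (rule countable_subset[OF _ countable_restricted]) blast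
  then have "countable (avoid ` ?LL \<union> speed ` (?MM \<times> ?LL))"
    by (intro countable_Un countable_image countable_SIGMA countable_computable)
  moreover have "dense G" if "G \<in> avoid ` ?LL \<union> speed ` (?MM \<times> ?LL)" for G
    using that
  proof
    assume "G \<in> avoid ` ?LL"
    then obtain L where "G = avoid L" by (rule imageE)
    then show ?thesis unfolding avoid_def by (simp only: dense_avoid)
  next
    assume "G \<in> speed ` (?MM \<times> ?LL)"
    then obtain M L where "G = speed (M, L)" "wf_otm M" by auto
    then show ?thesis unfolding speed_def by (simp only: prod.case dense_fast)
  qed
  ultimately have "\<exists>C. \<forall>G \<in> avoid ` ?LL \<union> speed ` (?MM \<times> ?LL). G C"
    by (rule generic_oracle)
  then obtain C where C: "\<forall>G \<in> avoid ` ?LL \<union> speed ` (?MM \<times> ?LL). G C"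
    by (rule exE)
  have "\<not> computable (length_oracle C)"
    using bspec[OF C, of "avoid (length_oracle C)"] by (auto simp: avoid_def)
  moreover have "low_for_speed (length_oracle C)"
    unfolding low_for_speed_def
  proof (intro allI impI)
    fix L M f assume L: "computable L" and dec: "decides_within (length_oracle C) M L f"
    then have M: "wf_otm M" by (simp add: decides_within_def)
    \<comment> \<open>The requirements cover restricted machines only; the restriction of
      \<open>M\<close> decides \<open>L\<close> within the same bound.\<close>
    then have "wf_otm (restrict_delta M)" by (simp add: wf_otm_def restrict_delta_def)
    then have "(restrict_delta M, L) \<in> ?MM \<times> ?LL" using L by simp
    then have "speed (restrict_delta M, L) C" by (rule bspec[OF C, OF UnI2, OF imageI])
    then show "\<exists>M' (p :: nat poly). no_oracle M' \<and> decides_within {} M' L (\<lambda>x. poly p (f x))"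
      using dec by (simp add: speed_def decides_within_restrict_delta[OF M] fast_def)
  qed
  ultimately show ?thesis by blast
qed

end
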